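(* Let $n,m,r$ be positive integers with $m,r\le n-2$, and let $(A,P)$ be a vertex of the contact graph $\mathcal{A}(\overline{D}_m,\overline{D}_r)$ of the free idempotent-generated semigroup $\mathsf{IG}(\mathcal{E}_{\mathcal{T}_n})$ over the biordered set of the full transformation monoid $\mathcal{T}_n$ (so $A$ is an $m$-element subset of $[1,n]$ and $P$ is a partition of $[1,n]$ into $r$ classes). If $(A,P)$ is not stationary, then its vertex group $W_{(A,P)}\le \mathbb{S}_m\times\mathbb{S}_r$ coincides with the auto-homeomorphism group $\mathrm{AHom}(A,P)$. Otherwise (if $(A,P)$ is stationary), $W_{(A,P)}$ is trivial.
   Context: Conventions: $[1,n]=\{1,\dots,n\}$; maps act on the right and are composed left to right; $\mathcal{T}_n$ is the monoid of all maps $[1,n]\to[1,n]$ and $E(\mathcal{T}_n)$ its set of idempotents; $\mathbb{S}_m$ is the symmetric group on $[1,m]$. For an $m$-element subset write $A=\{a_1<\dots<a_m\}$; for a partition $P$ of $[1,n]$ into $r$ classes write $P=\{P_1,\dots,P_r\}$ with $\min P_1<\dots<\min P_r$. $I_m$ is the set of partitions of $[1,n]$ into $m$ classes, $\Lambda_m$ the set of $m$-element subsets of $[1,n]$. For $A\in\Lambda_m$, $P\in I_m$, $A\perp P$ means that $A$ contains exactly one element of each class of $P$; then $\lambda(P,A)\in\mathbb{S}_m$ is the permutation $i\mapsto r_i$ where $a_{r_i}\in P_i$. Free idempotent-generated semigroup: a basic pair is a pair $\{e,f\}$ of idempotents of $\mathcal{T}_n$ with $\{ef,fe\}\cap\{e,f\}\ne\varnothing$.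 $\mathsf{IG}(\mathcal{E}_{\mathcal{T}_n})$ is the semigroup with generators $\overline{e}$, $e\in E(\mathcal{T}_n)$, and relations $\overline{e}\,\overline{f}=\overline{ef}$ for all basic pairs $\{e,f\}$. $\overline{D}_m$ is its regular $\mathscr{D}$-class containing all $\overline{e}$ with $\mathrm{rank}\,e=m$; its $\mathscr{R}$-classes are indexed by $I_m$ and its $\mathscr{L}$-classes by $\Lambda_m$ ($\overline{e}$ has indices $\ker e$ and $\mathrm{im}\,e$). Elements of $\overline{D}_m$ are written $(P,g,A)$ with $g$ in the maximal subgroup of $\overline{D}_m$, and the principal factor is a Rees matrix semigroup whose sandwich matrix has entries $f_{P,A}^{-1}$ for $A\perp P$ and $0$ otherwise. For $m\le n-2$ the maximal subgroup is identified with $\mathbb{S}_m$ in such a way that $f_{P,A}=\lambda(P,A)$ (a known result of Gray and Ruškuc). Actions: $\overline{e}\cdot P=Q$ means $\overline{e}(P,g,A)=(Q,h,A)$ for some $g,h,A$; $B\cdot\overline{e}=A$ means $(P,g,B)\overline{e}=(P,h,A)$ for some $P,g,h$. Concretely (known): $B\cdot\overline{e}$ is defined iff $e$ is injective on $B$, and then it equals $Be$; $\overline{e}\cdot P$ is defined iff $\mathrm{im}\,e$ meets every class of $P$, and then its classes are the sets $P_je^{-1}$. Contact graph $\mathcal{A}(\overline{D}_m,\overline{D}_r)$: the vertex set is $\Lambda_m\times I_r$. For each $e\in E(\mathcal{T}_n)$ with $A=B\cdot\overline{e}$ and $\overline{e}\cdot P=Q$ there is a directed edge $(A,P)\to(B,Q)$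 with group label $(a,b^{-1})\in\mathbb{S}_m\times\mathbb{S}_r$, where $a=\lambda(P_0,A)^{-1}\lambda(P_0,B)$ for any $P_0\in I_m$ with $\overline{e}\cdot P_0=P_0$, $A\perp P_0$, $B\perp P_0$, and $b=\lambda(Q,A_0)\lambda(P,A_0)^{-1}$ for any $A_0\in\Lambda_r$ with $A_0\cdot\overline{e}=A_0$, $A_0\perp P$, $A_0\perp Q$ (such $P_0,A_0$ exist and the choice is irrelevant). Edges may be traversed backwards, with the inverse label. The label of a walk is the product of the labels of its edges in order. The vertex group $W_{(A,P)}$ is the subgroup of all labels of closed walks based at $(A,P)$. $(A,P)$ is stationary if all classes of $P$ containing elements not in $A$ are singletons. $\mathrm{AHom}(A,P)$ is the group of all $(\pi,\pi')\in\mathbb{S}_m\times\mathbb{S}_r$ such that for all $1\le i\le m$, $1\le j\le r$: $a_i\in P_j$ if and only if $a_{i\pi}\in P_{j\pi'}$. *)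

theory Defs
  imports "HOL-Library.FuncSet" "HOL-Library.Disjoint_Sets" "HOL-Combinatorics.Permutations"
begin

text \<open>Maps act on the right and are composed from left to right: \<^term>\<open>tmul n e f\<close> is
  ``first e, then f''.\<close>

definition transf :: "nat \<Rightarrow> (nat \<Rightarrow> nat) set" where
  "transf n = {1..n} \<rightarrow>\<^sub>E {1..n}"

definition tmul :: "nat \<Rightarrow> (nat \<Rightarrow> nat) \<Rightarrow> (nat \<Rightarrow> nat) \<Rightarrow> (nat \<Rightarrow> nat)" where
  "tmul n e f = compose {1..n} f e"

definition idems :: "nat \<Rightarrow> (nat \<Rightarrow> nat) set" where
  "idems n = {e \<in> transf n. tmul n e e = e}"

definition im :: "nat \<Rightarrow> (nat \<Rightarrow> nat) \<Rightarrow> nat set" where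
  "im n e = e ` {1..n}"

definition rank :: "nat \<Rightarrow> (nat \<Rightarrow> nat) \<Rightarrow> nat" where
  "rank n e = card (im n e)"

definition ker :: "nat \<Rightarrow> (nat \<Rightarrow> nat) \<Rightarrow> nat set set" where
  "ker n e = {1..n} // {(x, y). x \<in> {1..n} \<and> y \<in> {1..n} \<and> e x = e y}"

definition Lam :: "nat \<Rightarrow> nat \<Rightarrow> nat set set" where
  "Lam n m = {A. A \<subseteq> {1..n} \<and> card A = m}"

definition Part :: "nat \<Rightarrow> nat \<Rightarrow> nat set set set" where
  "Part n m = {P. partition_on {1..n} P \<and> card P = m}"

text \<open>Indices are 1-based: \<^term>\<open>elt A i\<close> is $a_i$, and \<^term>\<open>cls P i\<close> is $P_i$.\<close>

definition elt :: "nat set \<Rightarrow> nat \<Rightarrow> nat" where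
  "elt A i = sorted_list_of_set A ! (i - 1)"

definition cls :: "nat set set \<Rightarrow> nat \<Rightarrow> nat set" where
  "cls P i = (THE C. C \<in> P \<and> Min C = elt (Min ` P) i)"

definition perp :: "nat set \<Rightarrow> nat set set \<Rightarrow> bool" (infix "\<bottom>\<bottom>" 50) where
  "A \<bottom>\<bottom> P \<longleftrightarrow> (\<forall>C\<in>P. \<exists>!x. x \<in> A \<and> x \<in> C)"

text \<open>Elements of the symmetric group on $[1,m]$ are functions \<^term>\<open>p\<close> with
  \<^term>\<open>p permutes {1..m}\<close>, hence are the identity outside $[1,m]$.  The value of
  \<open>lam P A\<close> is meaningful only if \<open>A \<bottom>\<bottom> P\<close>.\<close>

definition lam :: "nat set set \<Rightarrow> nat set \<Rightarrow> nat \<Rightarrow> nat" where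
  "lam P A i = (if i \<in> {1..card P}
     then (THE k. k \<in> {1..card A} \<and> elt A k \<in> cls P i) else i)"

text \<open>Permutations are composed from left to right, by \<^const>\<open>fcomp\<close>.\<close>

notation fcomp (infixl "\<circ>>" 60)

text \<open>For a semigroup with carrier \<open>S\<close> and multiplication \<open>mul\<close>: equality of principal
  right, respectively left, ideals $xS^1$ and $S^1x$, and their composition.\<close>

definition green_R :: "'a set \<Rightarrow> ('a \<Rightarrow> 'a \<Rightarrow> 'a) \<Rightarrow> 'a \<Rightarrow> 'a \<Rightarrow> bool" where
  "green_R S mul x y \<longleftrightarrow> x \<in> S \<and> y \<in> S \<and>
     insert x ((\<lambda>s. mul x s) ` S) = insert y ((\<lambda>s. mul y s) ` S)"

definition green_L :: "'a set \<Rightarrow> ('a \<Rightarrow> 'a \<Rightarrow> 'a) \<Rightarrow> 'a \<Rightarrow> 'a \<Rightarrow> bool" where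
  "green_L S mul x y \<longleftrightarrow> x \<in> S \<and> y \<in> S \<and>
     insert x ((\<lambda>s. mul s x) ` S) = insert y ((\<lambda>s. mul s y) ` S)"

definition green_D :: "'a set \<Rightarrow> ('a \<Rightarrow> 'a \<Rightarrow> 'a) \<Rightarrow> 'a \<Rightarrow> 'a \<Rightarrow> bool" where
  "green_D S mul x y \<longleftrightarrow> (\<exists>z. green_R S mul x z \<and> green_L S mul z y)"

definition basic_pair :: "nat \<Rightarrow> (nat \<Rightarrow> nat) \<Rightarrow> (nat \<Rightarrow> nat) \<Rightarrow> bool" where
  "basic_pair n e f \<longleftrightarrow> e \<in> idems n \<and> f \<in> idems n \<and>
     {tmul n e f, tmul n f e} \<inter> {e, f} \<noteq> {}"

definition ig_words :: "nat \<Rightarrow> (nat \<Rightarrow> nat) list set" where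
  "ig_words n = {w. w \<noteq> [] \<and> set w \<subseteq> idems n}"

inductive ig_cong :: "nat \<Rightarrow> (nat \<Rightarrow> nat) list \<Rightarrow> (nat \<Rightarrow> nat) list \<Rightarrow> bool" for n where
  rel: "basic_pair n e f \<Longrightarrow> ig_cong n [e, f] [tmul n e f]"
| refl: "w \<in> ig_words n \<Longrightarrow> ig_cong n w w"
| sym: "ig_cong n u v \<Longrightarrow> ig_cong n v u"
| trans: "ig_cong n u v \<Longrightarrow> ig_cong n v w \<Longrightarrow> ig_cong n u w"
| mult: "ig_cong n u u' \<Longrightarrow> ig_cong n v v' \<Longrightarrow> ig_cong n (u @ v) (u' @ v')"

definition ig_rel :: "nat \<Rightarrow> ((nat \<Rightarrow> nat) list \<times> (nat \<Rightarrow> nat) list) set" where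
  "ig_rel n = {(u, v). ig_cong n u v}"

type_synonym ig = "(nat \<Rightarrow> nat) list set"

definition IG :: "nat \<Rightarrow> ig set" where
  "IG n = ig_words n // ig_rel n"

definition ig_mul :: "nat \<Rightarrow> ig \<Rightarrow> ig \<Rightarrow> ig" where
  "ig_mul n X Y = (\<Union>u\<in>X. \<Union>v\<in>Y. ig_rel n `` {u @ v})"

definition gen :: "nat \<Rightarrow> (nat \<Rightarrow> nat) \<Rightarrow> ig" where
  "gen n e = ig_rel n `` {[e]}"

definition Dbar :: "nat \<Rightarrow> nat \<Rightarrow> ig set" where
  "Dbar n m = {x \<in> IG n. \<exists>e\<in>idems n. rank n e = m \<and> green_D (IG n) (ig_mul n) x (gen n e)}"

text \<open>\<open>has_indices n m x P A\<close> says that \<open>x\<close> is of the form $(P,g,A)$ for some \<open>g\<close>, that is,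
  it lies in the R-class with index \<open>P\<close> and in the L-class with index \<open>A\<close> of \<open>Dbar n m\<close>.\<close>

definition has_indices :: "nat \<Rightarrow> nat \<Rightarrow> ig \<Rightarrow> nat set set \<Rightarrow> nat set \<Rightarrow> bool" where
  "has_indices n m x P A \<longleftrightarrow> x \<in> Dbar n m \<and>
     (\<exists>e\<in>idems n. rank n e = m \<and> ker n e = P \<and> green_R (IG n) (ig_mul n) x (gen n e)) \<and>
     (\<exists>f\<in>idems n. rank n f = m \<and> im n f = A \<and> green_L (IG n) (ig_mul n) x (gen n f))"

text \<open>\<open>left_act n m e P Q\<close> is $\overline{e} \cdot P = Q$ and \<open>right_act n m B e A\<close> is
  $B \cdot \overline{e} = A$, both for the indices of \<open>Dbar n m\<close>.\<close>

definition left_act :: "nat \<Rightarrow> nat \<Rightarrow> (nat \<Rightarrow> nat) \<Rightarrow> nat set set \<Rightarrow> nat set set \<Rightarrow> bool" where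
  "left_act n m e P Q \<longleftrightarrow>
     (\<exists>x A. has_indices n m x P A \<and> has_indices n m (ig_mul n (gen n e) x) Q A)"

definition right_act :: "nat \<Rightarrow> nat \<Rightarrow> nat set \<Rightarrow> (nat \<Rightarrow> nat) \<Rightarrow> nat set \<Rightarrow> bool" where
  "right_act n m B e A \<longleftrightarrow>
     (\<exists>x P. has_indices n m x P B \<and> has_indices n m (ig_mul n x (gen n e)) P A)"

type_synonym vertex = "nat set \<times> nat set set"
type_synonym label = "(nat \<Rightarrow> nat) \<times> (nat \<Rightarrow> nat)"

definition vertices :: "nat \<Rightarrow> nat \<Rightarrow> nat \<Rightarrow> vertex set" where
  "vertices n m r = Lam n m \<times> Part n r"

definition label_mul :: "label \<Rightarrow> label \<Rightarrow> label" where
  "label_mul g h = (fst g \<circ>> fst h, snd g \<circ>> snd h)"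

definition label_inv :: "label \<Rightarrow> label" where
  "label_inv g = (inv (fst g), inv (snd g))"

text \<open>\<open>edge n m r (A, P) l (B, Q)\<close>: there is an edge from $(A,P)$ to $(B,Q)$ with label \<open>l\<close>.
  The auxiliary \<open>P0\<close> and \<open>A0\<close> always exist and do not influence the label, so
  quantifying them existentially adds and removes no edges.

  The maximal subgroup of \<open>Dbar n m\<close> enters only through \<open>lam\<close>: for $m \le n-2$ it is
  identified (Gray and Ruskuc) with the symmetric group on $[1,m]$ in such a way that the
  sandwich matrix has the entries $\lambda(P,A)^{-1}$ for $A \perp P$, and 0 otherwise.\<close>

inductive edge :: "nat \<Rightarrow> nat \<Rightarrow> nat \<Rightarrow> vertex \<Rightarrow> label \<Rightarrow> vertex \<Rightarrow> bool" for n m r where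
  "\<lbrakk> (A, P) \<in> vertices n m r; (B, Q) \<in> vertices n m r;
     e \<in> idems n; right_act n m B e A; left_act n r e P Q;
     P0 \<in> Part n m; left_act n m e P0 P0; A \<bottom>\<bottom> P0; B \<bottom>\<bottom> P0;
     A0 \<in> Lam n r; right_act n r A0 e A0; A0 \<bottom>\<bottom> P; A0 \<bottom>\<bottom> Q;
     a = inv (lam P0 A) \<circ>> lam P0 B;
     b = lam Q A0 \<circ>> inv (lam P A0) \<rbrakk>
   \<Longrightarrow> edge n m r (A, P) (a, inv b) (B, Q)"

text \<open>\<open>walk n m r u g v\<close>: there is a walk from \<open>u\<close> to \<open>v\<close> with label \<open>g\<close>.\<close>

inductive walk :: "nat \<Rightarrow> nat \<Rightarrow> nat \<Rightarrow> vertex \<Rightarrow> label \<Rightarrow> vertex \<Rightarrow> bool" for n m r where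
  empty: "v \<in> vertices n m r \<Longrightarrow> walk n m r v (id, id) v"
| forward: "walk n m r u g v \<Longrightarrow> edge n m r v l w \<Longrightarrow> walk n m r u (label_mul g l) w"
| backward: "walk n m r u g v \<Longrightarrow> edge n m r w l v
    \<Longrightarrow> walk n m r u (label_mul g (label_inv l)) w"

definition vertex_group :: "nat \<Rightarrow> nat \<Rightarrow> nat \<Rightarrow> vertex \<Rightarrow> label set" where
  "vertex_group n m r v = {g. walk n m r v g v}"

definition stationary :: "nat set \<Rightarrow> nat set set \<Rightarrow> bool" where
  "stationary A P \<longleftrightarrow> (\<forall>C\<in>P. (\<exists>x\<in>C. x \<notin> A) \<longrightarrow> is_singleton C)"

definition AHom :: "nat set \<Rightarrow> nat set set \<Rightarrow> label set" where
  "AHom A P = {(\<pi>, \<pi>'). \<pi> permutes {1..card A} \<and> \<pi>' permutes {1..card P} \<and>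
     (\<forall>i\<in>{1..card A}. \<forall>j\<in>{1..card P}.
        elt A i \<in> cls P j \<longleftrightarrow> elt A (\<pi> i) \<in> cls P (\<pi>' j))}"

end

theory Submission
  imports Defs
begin

text \<open>
  An edge of the contact graph turns out to have a very simple meaning once vertices and labels
  are read together.  A vertex \<open>(B, Q)\<close> with a label \<open>(a, c)\<close> is the same thing as an injection
  \<open>\<alpha> : {1..m} \<rightarrow> {1..n}\<close> with image \<open>B\<close>, namely \<open>k \<mapsto> elt B (a k)\<close>, and a surjection
  \<open>\<beta> : {1..n} \<rightarrow> {1..r}\<close> with set of fibres \<open>Q\<close>, where \<open>cls Q (c l)\<close> is the fibre of \<open>l\<close>.  In
  this reading every edge goes from \<open>(\<alpha>' e, \<beta>)\<close> to \<open>(\<alpha>', e \<beta>)\<close>, with maps on the right as usual,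
  for an idempotent \<open>e\<close> (lemma \<open>edge_iff\<close>).

  To get there one needs the actions of a generator on the R- and L-classes (\<open>right_act_iff\<close>,
  \<open>left_act_iff\<close>).  The evaluation homomorphism from the free idempotent-generated semigroup to
  the full transformation monoid shows that they can only be \<open>B \<mapsto> B e\<close> and \<open>P \<mapsto> P e\<inverse>\<close>.  That
  they are defined whenever these formulas make sense follows by choosing in the relevant L- or
  R-class an idempotent \<open>h\<close> that forms a basic pair with \<open>e\<close>: then the product with \<open>e\<close> is a
  generator again.

  The composite \<open>\<alpha> \<beta> : {1..m} \<rightarrow> {1..r}\<close> does not change along an edge.  For closed walks this
  says that every label is an auto-homeomorphism (\<open>walk_homeo\<close>).

  If \<open>(A, P)\<close> is stationary, then \<open>e\<close> must be the identity for every edge at \<open>(A, P)\<close>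
  (\<open>stationary_edge\<close>), so that the vertex group is trivial.

  Otherwise, regard \<open>\<alpha>\<close> as a placement of \<open>m\<close> tokens on \<open>n\<close> positions and \<open>\<beta>\<close> as a colouring of
  the positions.  Idempotents that move a single point allow to recolour a position without a
  token, as long as no colour gets lost, and to move a token to a free position of the same
  colour.  Choose a representative position of every colour that occurs below no token.  Tokens
  and representatives together can be moved about like the pieces of a sliding puzzle on a
  complete graph, and non-stationarity says exactly that some position is occupied by neither.
  So any two configurations with the same \<open>\<alpha> \<beta>\<close> are connected (\<open>puzzle_connected\<close>).  Applied to
  the configurations of the labels \<open>(id, id)\<close> and \<open>(\<pi>, \<pi>')\<close> at the vertex \<open>(A, P)\<close>, this yields
  a closed walk with label \<open>(\<pi>, \<pi>')\<close> for every auto-homeomorphism.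
\<close>

(* Otherwise the interval {1..n}, which is only a set of points here, is rewritten to
   inequalities. *)
declare One_nat_def [simp del] atLeastAtMost_iff [simp del]

section \<open>Idempotents and kernels\<close>

lemma idems_iff:
  "e \<in> idems n \<longleftrightarrow> e \<in> extensional {1..n} \<and> (\<forall>x\<in>{1..n}. e x \<in> {1..n} \<and> e (e x) = e x)"
proof -
  have "compose {1..n} e e = e \<longleftrightarrow> (\<forall>x\<in>{1..n}. e (e x) = e x)" if "e \<in> extensional {1..n}"
  proof
    assume "compose {1..n} e e = e"
    then show "\<forall>x\<in>{1..n}. e (e x) = e x" by (metis compose_eq)
  next
    assume "\<forall>x\<in>{1..n}. e (e x) = e x"
    then show "compose {1..n} e e = e"
      using that by (intro extensionalityI[of _ "{1..n}"]) (auto simp: compose_eq)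
  qed
  then show ?thesis
    unfolding idems_def transf_def tmul_def by (auto simp: PiE_def Pi_def)
qed

lemma idems_in: "e \<in> idems n \<Longrightarrow> x \<in> {1..n} \<Longrightarrow> e x \<in> {1..n}"
  and idems_idem: "e \<in> idems n \<Longrightarrow> x \<in> {1..n} \<Longrightarrow> e (e x) = e x"
  by (auto simp: idems_iff)

lemma restrict_idem:
  assumes "\<And>x. x \<in> {1..n} \<Longrightarrow> f x \<in> {1..n}" and "\<And>x. x \<in> {1..n} \<Longrightarrow> f (f x) = f x"
  shows "restrict f {1..n} \<in> idems n"
  unfolding idems_iff using assms by (simp add: restrict_def extensional_def)

lemma tmul_apply: "x \<in> {1..n} \<Longrightarrow> tmul n e f x = f (e x)"
  by (simp add: tmul_def compose_eq)

lemma tmul_extensional: "tmul n e f \<in> extensional {1..n}"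
  by (simp add: tmul_def)

lemma tmul_eq_iff:
  assumes "g \<in> idems n"
  shows "tmul n e f = g \<longleftrightarrow> (\<forall>x\<in>{1..n}. f (e x) = g x)"
proof
  assume "\<forall>x\<in>{1..n}. f (e x) = g x"
  with assms show "tmul n e f = g"
    by (intro extensionalityI[of _ "{1..n}", OF tmul_extensional])
      (auto simp: tmul_apply idems_iff)
qed (use tmul_apply in fastforce)

lemma ker_eq: "ker n h = (\<lambda>y. {x \<in> {1..n}. h x = y}) ` h ` {1..n}"
proof -
  have "{(x, y). x \<in> {1..n} \<and> y \<in> {1..n} \<and> h x = h y} `` {x} = {z \<in> {1..n}. h z = h x}"
    if "x \<in> {1..n}" for x
    using that by auto
  then show ?thesis unfolding ker_def quotient_def by (auto simp: image_iff)
qed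

lemma ker_eqI:
  assumes "\<And>x y. x \<in> {1..n} \<Longrightarrow> y \<in> {1..n} \<Longrightarrow> h x = h y \<longleftrightarrow> h' x = h' y"
  shows "ker n h = ker n h'"
proof -
  have "{(x, y). x \<in> {1..n} \<and> y \<in> {1..n} \<and> h x = h y}
    = {(x, y). x \<in> {1..n} \<and> y \<in> {1..n} \<and> h' x = h' y}"
    using assms by auto
  then show ?thesis by (simp add: ker_def)
qed

lemma ker_cong: "(\<And>x. x \<in> {1..n} \<Longrightarrow> h x = h' x) \<Longrightarrow> ker n h = ker n h'"
  by (rule ker_eqI) simp

lemma partition_on_ker: "partition_on {1..n} (ker n h)"
  unfolding ker_def
  by (rule partition_on_quotient) (auto simp: equiv_def refl_on_def sym_def trans_def)

lemma card_ker: "card (ker n h) = card (h ` {1..n})"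
  unfolding ker_eq by (rule card_image, rule inj_onI) blast

lemma basic_pair_tmul:
  assumes "basic_pair n e f"
  shows "tmul n e f \<in> idems n"
proof -
  from assms have e: "e \<in> idems n" and f: "f \<in> idems n"
    and "tmul n e f = e \<or> tmul n e f = f \<or> tmul n f e = e \<or> tmul n f e = f"
    by (auto simp: basic_pair_def)
  then have "(\<forall>x\<in>{1..n}. f (e x) = e x) \<or> (\<forall>x\<in>{1..n}. f (e x) = f x) \<or>
    (\<forall>x\<in>{1..n}. e (f x) = e x) \<or> (\<forall>x\<in>{1..n}. e (f x) = f x)"
    by (simp only: tmul_eq_iff)
  moreover have "\<forall>x\<in>{1..n}. e x \<in> {1..n} \<and> e (e x) = e x" "\<forall>x\<in>{1..n}. f x \<in> {1..n} \<and> f (f x) = f x"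
    using e f unfolding idems_iff by blast+
  ultimately have "\<forall>x\<in>{1..n}. f (e (f (e x))) = f (e x)"
    by metis
  then show ?thesis
    using e f unfolding idems_iff by (simp add: tmul_apply tmul_extensional)
qed

section \<open>The free idempotent-generated semigroup and its actions\<close>

text \<open>Evaluation of a word in the full transformation monoid, from left to right.\<close>

primrec act :: "(nat \<Rightarrow> nat) list \<Rightarrow> nat \<Rightarrow> nat" where
  "act [] x = x"
| "act (e # w) x = act w (e x)"

lemma act_append: "act (u @ v) x = act v (act u x)"
  by (induction u arbitrary: x) simp_all

lemma ig_cong_words: "ig_cong n u v \<Longrightarrow> u \<in> ig_words n \<and> v \<in> ig_words n"
proof (induction rule: ig_cong.induct)
  case (rel e f)
  with basic_pair_tmul[OF rel] show ?case by (simp add: ig_words_def basic_pair_def)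
qed (auto simp: ig_words_def)

lemma word_eval_in: "set w \<subseteq> idems n \<Longrightarrow> x \<in> {1..n} \<Longrightarrow> act w x \<in> {1..n}"
proof (induction w arbitrary: x)
  case (Cons e w)
  then have "e x \<in> {1..n}" by (simp add: idems_in)
  moreover have "set w \<subseteq> idems n" using Cons.prems by simp
  ultimately show ?case using Cons.IH by simp
qed simp

lemma ig_cong_eval: "ig_cong n u v \<Longrightarrow> x \<in> {1..n} \<Longrightarrow> act u x = act v x"
proof (induction arbitrary: x rule: ig_cong.induct)
  case (rel e f)
  then show ?case by (simp add: tmul_apply)
next
  case (mult u u' v v')
  from mult(1,5) have "act u x \<in> {1..n}"
    using ig_cong_words word_eval_in unfolding ig_words_def by blast
  with mult show ?case by (simp add: act_append)
qed auto

lemma equiv_ig_rel: "equiv (ig_words n) (ig_rel n)"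
  unfolding equiv_def refl_on_def sym_def trans_def ig_rel_def
  by (auto intro: ig_cong.intros dest: ig_cong_words)

abbreviation wcls :: "nat \<Rightarrow> (nat \<Rightarrow> nat) list \<Rightarrow> ig" where
  "wcls n w \<equiv> ig_rel n `` {w}"

lemma IG_cases:
  assumes "x \<in> IG n"
  obtains w where "w \<in> ig_words n" "x = wcls n w"
  using assms unfolding IG_def by (rule quotientE)

lemma wcls_in_IG: "w \<in> ig_words n \<Longrightarrow> wcls n w \<in> IG n"
  unfolding IG_def by (rule quotientI)

lemma wcls_eq_iff: "u \<in> ig_words n \<Longrightarrow> v \<in> ig_words n \<Longrightarrow> wcls n u = wcls n v \<longleftrightarrow> ig_cong n u v"
  using eq_equiv_class_iff[OF equiv_ig_rel, of u n v] by (simp add: ig_rel_def)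

lemma append_ig_words: "u \<in> ig_words n \<Longrightarrow> v \<in> ig_words n \<Longrightarrow> u @ v \<in> ig_words n"
  by (auto simp: ig_words_def)

lemma ig_mul_wcls:
  assumes "u \<in> ig_words n" "v \<in> ig_words n"
  shows "ig_mul n (wcls n u) (wcls n v) = wcls n (u @ v)"
proof -
  have "wcls n (u' @ v') = wcls n (u @ v)" if "u' \<in> wcls n u" "v' \<in> wcls n v" for u' v'
  proof -
    from that have "ig_cong n (u' @ v') (u @ v)"
      by (auto simp: ig_rel_def intro: ig_cong.intros)
    then show ?thesis using ig_cong_words wcls_eq_iff by blast
  qed
  moreover have "u \<in> wcls n u" "v \<in> wcls n v"
    using assms by (auto simp: ig_rel_def intro: ig_cong.refl)
  ultimately show ?thesis unfolding ig_mul_def by blast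
qed

lemma gen_word: "e \<in> idems n \<Longrightarrow> [e] \<in> ig_words n"
  by (simp add: ig_words_def)

lemma gen_mul:
  assumes "basic_pair n e f"
  shows "ig_mul n (gen n e) (gen n f) = gen n (tmul n e f)"
proof -
  have w: "[e] \<in> ig_words n" "[f] \<in> ig_words n" "[tmul n e f] \<in> ig_words n"
    using assms basic_pair_tmul[OF assms] by (auto simp: basic_pair_def ig_words_def)
  have "ig_cong n [e, f] [tmul n e f]" by (rule ig_cong.rel[OF assms])
  then have "wcls n ([e] @ [f]) = wcls n [tmul n e f]"
    using ig_cong_words wcls_eq_iff by (metis append_Cons append_Nil)
  then show ?thesis using ig_mul_wcls w by (simp add: gen_def)
qed

lemma has_indices_gen:
  assumes "f \<in> idems n" "rank n f = m"
  shows "has_indices n m (gen n f) (ker n f) (im n f)"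
proof -
  have "gen n f \<in> IG n" unfolding gen_def by (rule wcls_in_IG[OF gen_word[OF assms(1)]])
  with assms show ?thesis
    unfolding has_indices_def Dbar_def green_D_def green_R_def green_L_def by blast
qed

text \<open>If \<open>x = y s\<close>, then evaluation turns \<open>x\<close> into the value of \<open>y\<close> followed by another map, so
  the kernel of \<open>y\<close> is contained in that of \<open>x\<close>.  Dually, if \<open>x = s y\<close>, then the image of \<open>x\<close> is
  contained in that of \<open>y\<close>.\<close>

lemma green_R_ker:
  assumes "green_R (IG n) (ig_mul n) (wcls n u) (wcls n v)" "u \<in> ig_words n" "v \<in> ig_words n"
  shows "ker n (act u) = ker n (act v)"
proof -
  have right: "\<exists>g. \<forall>x\<in>{1..n}. act u x = g (act v x)"
    if uv: "wcls n u \<in> insert (wcls n v) ((\<lambda>s. ig_mul n (wcls n v) s) ` IG n)"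
      "u \<in> ig_words n" "v \<in> ig_words n" for u v
  proof -
    from uv consider "wcls n u = wcls n v" | s where "s \<in> IG n" "wcls n u = ig_mul n (wcls n v) s"
      by auto
    then show ?thesis
    proof cases
      case 1
      then have "\<forall>x\<in>{1..n}. act u x = id (act v x)"
        using uv(2,3) wcls_eq_iff ig_cong_eval by auto
      then show ?thesis by blast
    next
      case 2
      then obtain w where w: "w \<in> ig_words n" "s = wcls n w" by (auto elim: IG_cases)
      with 2 uv have "wcls n u = wcls n (v @ w)" by (simp add: ig_mul_wcls)
      with uv w have "ig_cong n u (v @ w)" using wcls_eq_iff append_ig_words by blast
      then have "\<forall>x\<in>{1..n}. act u x = act w (act v x)"
        using ig_cong_eval by (fastforce simp: act_append)
      then show ?thesis by blast
    qed
  qed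
  have eq: "insert (wcls n u) ((\<lambda>s. ig_mul n (wcls n u) s) ` IG n)
    = insert (wcls n v) ((\<lambda>s. ig_mul n (wcls n v) s) ` IG n)"
    using assms(1) unfolding green_R_def by (elim conjE)
  have "wcls n u \<in> insert (wcls n v) ((\<lambda>s. ig_mul n (wcls n v) s) ` IG n)"
    unfolding eq[symmetric] by (rule insertI1)
  moreover have "wcls n v \<in> insert (wcls n u) ((\<lambda>s. ig_mul n (wcls n u) s) ` IG n)"
    unfolding eq by (rule insertI1)
  ultimately obtain g g' where "\<forall>x\<in>{1..n}. act u x = g (act v x)"
    "\<forall>x\<in>{1..n}. act v x = g' (act u x)"
    using right assms by meson
  then show ?thesis by (intro ker_eqI) metis
qed

lemma green_L_im:
  assumes "green_L (IG n) (ig_mul n) (wcls n u) (wcls n v)" "u \<in> ig_words n" "v \<in> ig_words n"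
  shows "im n (act u) = im n (act v)"
proof -
  have left: "im n (act u) \<subseteq> im n (act v)"
    if uv: "wcls n u \<in> insert (wcls n v) ((\<lambda>s. ig_mul n s (wcls n v)) ` IG n)"
      "u \<in> ig_words n" "v \<in> ig_words n" for u v
  proof -
    from uv consider "wcls n u = wcls n v" | s where "s \<in> IG n" "wcls n u = ig_mul n s (wcls n v)"
      by auto
    then show ?thesis
    proof cases
      case 1
      then have "\<forall>x\<in>{1..n}. act u x = act v x"
        using uv(2,3) wcls_eq_iff ig_cong_eval by auto
      then show ?thesis by (auto simp: im_def)
    next
      case 2
      then obtain w where w: "w \<in> ig_words n" "s = wcls n w" by (auto elim: IG_cases)
      with 2 uv have "wcls n u = wcls n (w @ v)" by (simp add: ig_mul_wcls)
      with uv w have "ig_cong n u (w @ v)" using wcls_eq_iff append_ig_words by blast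
      then have "\<forall>x\<in>{1..n}. act u x = act v (act w x)"
        using ig_cong_eval by (fastforce simp: act_append)
      moreover have "\<forall>x\<in>{1..n}. act w x \<in> {1..n}"
        using w word_eval_in unfolding ig_words_def by blast
      ultimately show ?thesis by (auto simp: im_def)
    qed
  qed
  have eq: "insert (wcls n u) ((\<lambda>s. ig_mul n s (wcls n u)) ` IG n)
    = insert (wcls n v) ((\<lambda>s. ig_mul n s (wcls n v)) ` IG n)"
    using assms(1) unfolding green_L_def by (elim conjE)
  have "wcls n u \<in> insert (wcls n v) ((\<lambda>s. ig_mul n s (wcls n v)) ` IG n)"
    unfolding eq[symmetric] by (rule insertI1)
  moreover have "wcls n v \<in> insert (wcls n u) ((\<lambda>s. ig_mul n s (wcls n u)) ` IG n)"
    unfolding eq by (rule insertI1)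
  ultimately show ?thesis using assms(2,3) by (intro equalityI left)
qed

lemma has_indicesD:
  assumes "has_indices n m x P A"
  obtains w where "w \<in> ig_words n" "x = wcls n w"
    and "P = ker n (act w)" "A = im n (act w)"
proof -
  from assms have "x \<in> IG n" by (simp add: has_indices_def Dbar_def)
  then obtain w where w: "w \<in> ig_words n" "x = wcls n w" by (rule IG_cases)
  from assms obtain e f where e: "e \<in> idems n" "ker n e = P" "green_R (IG n) (ig_mul n) x (gen n e)"
    and f: "f \<in> idems n" "im n f = A" "green_L (IG n) (ig_mul n) x (gen n f)"
    unfolding has_indices_def by blast
  have "ker n (act w) = ker n (act [e])"
    using green_R_ker e w gen_word unfolding gen_def by blast
  moreover have "im n (act w) = im n (act [f])"
    using green_L_im f w gen_word unfolding gen_def by blast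
  moreover have "act [g] = g" for g by (rule ext) simp
  ultimately show thesis using that w e f by simp
qed

text \<open>The class \<open>C e\<inverse>\<close>.\<close>

definition pre :: "nat \<Rightarrow> (nat \<Rightarrow> nat) \<Rightarrow> nat set \<Rightarrow> nat set" where
  "pre n e C = {x \<in> {1..n}. e x \<in> C}"

lemma Lam_finite: "A \<in> Lam n m \<Longrightarrow> finite A"
  unfolding Lam_def using finite_subset by blast

lemma Part_finite: "P \<in> Part n m \<Longrightarrow> finite P"
  unfolding Part_def using finite_elements[of "{1..n}"] by blast

lemma im_inj:
  assumes "e ` B \<in> Lam n m" "B \<in> Lam n m" shows "inj_on e B"
  using assms Lam_finite[OF assms(2)] by (intro eq_card_imp_inj_on) (auto simp: Lam_def)

text \<open>The idempotent \<open>h\<close> below collapses every kernel class of \<open>e\<close> to a single point, so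
  \<open>{e, h}\<close> is a basic pair; this is what puts the product of the generators of \<open>h\<close> and \<open>e\<close> into
  the D-class of \<open>h\<close>.  Its kernel is moreover a partition fixed by \<open>e\<close>, for which \<open>B\<close> and its
  image under \<open>e\<close> are transversals.\<close>

lemma idempotent_with_image:
  assumes e: "e \<in> idems n" and B: "B \<subseteq> {1..n}" "B \<noteq> {}" "inj_on e B"
  obtains h where "h \<in> idems n" "im n h = B" "\<And>x. x \<in> {1..n} \<Longrightarrow> h (e x) = h x"
proof -
  obtain b0 where b0: "b0 \<in> B" using B by blast
  define f where "f x = inv_into B e (if e x \<in> e ` B then e x else e b0)" for x
  have fB: "f x \<in> B" for x unfolding f_def using b0 by (auto intro!: inv_into_into)
  have fb: "f x = x" if "x \<in> B" for x using that B by (simp add: f_def)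
  have fe: "f (e x) = f x" if "x \<in> {1..n}" for x using that e by (simp add: f_def idems_iff)
  show thesis
  proof (rule that[of "restrict f {1..n}"])
    show "restrict f {1..n} \<in> idems n"
      using fB B fb by (intro restrict_idem) blast+
    show "im n (restrict f {1..n}) = B"
      unfolding im_def using fB fb B by (force simp: image_iff)
    show "restrict f {1..n} (e x) = restrict f {1..n} x" if "x \<in> {1..n}" for x
      using that fe e by (simp add: idems_iff)
  qed
qed

text \<open>Dually, if the image of \<open>e\<close> meets every class of \<open>P\<close>, the representatives of the classes
  can be taken among the points fixed by \<open>e\<close>.\<close>

lemma idempotent_with_kernel:
  assumes e: "e \<in> idems n" and P: "partition_on {1..n} P" and ne: "\<And>C. C \<in> P \<Longrightarrow> pre n e C \<noteq> {}"
  obtains h where "h \<in> idems n" "ker n h = P" "\<And>x. x \<in> {1..n} \<Longrightarrow> e (h x) = h x"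
proof -
  have "\<exists>y. y \<in> C \<and> e y = y" if "C \<in> P" for C
  proof -
    from ne[OF that] obtain x where "x \<in> {1..n}" "e x \<in> C" by (auto simp: pre_def)
    with e show ?thesis by (intro exI[of _ "e x"]) (simp add: idems_iff)
  qed
  then obtain g where g: "\<And>C. C \<in> P \<Longrightarrow> g C \<in> C \<and> e (g C) = g C" by metis
  have ex1: "\<exists>!C. C \<in> P \<and> x \<in> C" if "x \<in> {1..n}" for x
    using P that by (auto simp: partition_on_def disjoint_def)
  define cl where "cl x = (THE C. C \<in> P \<and> x \<in> C)" for x
  have cl: "cl x \<in> P \<and> x \<in> cl x" if "x \<in> {1..n}" for x
    unfolding cl_def by (rule theI'[OF ex1[OF that]])
  have sub: "C \<subseteq> {1..n}" if "C \<in> P" for C using P that by (auto simp: partition_on_def)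
  have cl_eq: "cl x = C" if "C \<in> P" "x \<in> C" for x C
    using ex1[of x] cl[of x] sub[of C] that by blast
  define f where "f x = g (cl x)" for x
  have fC: "f x \<in> C" if "C \<in> P" "x \<in> C" for x C
    using that g[OF that(1)] by (simp add: f_def cl_eq)
  have ff: "f (f x) = f x" if "x \<in> {1..n}" for x
    using cl_eq fC cl[OF that] unfolding f_def by metis
  have fn: "f x \<in> {1..n}" if "x \<in> {1..n}" for x
    using fC sub cl[OF that] by blast
  show thesis
  proof (rule that[of "restrict f {1..n}"])
    show "restrict f {1..n} \<in> idems n" using ff fn by (rule restrict_idem[rotated])
    have feq: "f x = f y \<longleftrightarrow> y \<in> cl x" if "x \<in> {1..n}" "y \<in> {1..n}" for x y
      using that cl cl_eq fC unfolding f_def by metis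
    have "ker n f = cl ` {1..n}"
      unfolding ker_def quotient_def using feq cl sub by (fastforce simp: image_iff)
    also have "\<dots> = P"
    proof
      show "cl ` {1..n} \<subseteq> P" using cl by auto
      show "P \<subseteq> cl ` {1..n}"
      proof
        fix C assume C: "C \<in> P"
        then obtain x where "x \<in> C" using g by blast
        then show "C \<in> cl ` {1..n}" using cl_eq[OF C] sub[OF C] by blast
      qed
    qed
    finally show "ker n (restrict f {1..n}) = P"
      using ker_cong[of n "restrict f {1..n}" f] by simp
    show "e (restrict f {1..n} x) = restrict f {1..n} x" if "x \<in> {1..n}" for x
      using that g cl by (simp add: f_def)
  qed
qed

text \<open>The witness for the action is the generator of \<open>h\<close>: the product \<open>h e\<close> is again idempotent,
  has the kernel of \<open>h\<close> and the image \<open>B e\<close>.\<close>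

lemma right_act_iff:
  assumes e: "e \<in> idems n" and A: "A \<in> Lam n m" and B: "B \<in> Lam n m" and m: "0 < m"
  shows "right_act n m B e A \<longleftrightarrow> A = e ` B"
proof
  assume "right_act n m B e A"
  then obtain x P where x: "has_indices n m x P B" "has_indices n m (ig_mul n x (gen n e)) P A"
    by (auto simp: right_act_def)
  from x(1) obtain w where w: "w \<in> ig_words n" "x = wcls n w" "B = im n (act w)"
    by (rule has_indicesD)
  from x(2) obtain v where v: "v \<in> ig_words n" "ig_mul n x (gen n e) = wcls n v"
    "A = im n (act v)"
    by (rule has_indicesD)
  have "wcls n v = wcls n (w @ [e])"
    using v w ig_mul_wcls[OF w(1) gen_word[OF e]] by (simp add: gen_def)
  then have "ig_cong n v (w @ [e])"
    using wcls_eq_iff v w append_ig_words gen_word[OF e] by blast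
  then have "\<forall>x\<in>{1..n}. act v x = e (act w x)"
    using ig_cong_eval by (fastforce simp: act_append)
  then show "A = e ` B" using v w by (auto simp: im_def image_image)
next
  assume eq: "A = e ` B"
  then have inj: "inj_on e B" using im_inj A B by blast
  have "B \<noteq> {}" using B m by (auto simp: Lam_def)
  with e B inj obtain h where h: "h \<in> idems n" "im n h = B" "\<And>x. x \<in> {1..n} \<Longrightarrow> h (e x) = h x"
    by (auto simp: Lam_def elim: idempotent_with_image)
  have "tmul n e h = h" using h by (simp add: tmul_eq_iff)
  then have bp: "basic_pair n h e" using h e by (auto simp: basic_pair_def)
  have im: "im n (tmul n h e) = A"
    using eq h(2) by (auto simp: im_def tmul_apply image_image)
  have "ker n (tmul n h e) = ker n h"
    using inj h(2) by (intro ker_eqI) (auto simp: tmul_apply im_def inj_on_def)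
  moreover have "has_indices n m (gen n (tmul n h e)) (ker n (tmul n h e)) (im n (tmul n h e))"
    using basic_pair_tmul[OF bp] im A by (intro has_indices_gen) (auto simp: rank_def Lam_def)
  moreover have "has_indices n m (gen n h) (ker n h) (im n h)"
    using h B by (intro has_indices_gen) (auto simp: rank_def Lam_def)
  ultimately show "right_act n m B e A"
    unfolding right_act_def using im h(2) gen_mul[OF bp] by metis
qed

text \<open>Classes of \<open>g\<close> that the image of \<open>e\<close> misses have an empty preimage, which is not a class.\<close>

lemma ker_pre: 
  assumes "e \<in> idems n"
  shows "ker n (\<lambda>x. g (e x)) = pre n e ` ker n g - {{}}"
proof -
  have en: "e x \<in> {1..n}" if "x \<in> {1..n}" for x using assms that by (simp add: idems_iff)
  have pre: "pre n e {x \<in> {1..n}. g x = y} = {x \<in> {1..n}. g (e x) = y}" for y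
    using en by (auto simp: pre_def)
  show ?thesis unfolding ker_eq
  proof (intro equalityI subsetI)
    fix C assume "C \<in> (\<lambda>y. {x \<in> {1..n}. g (e x) = y}) ` (\<lambda>x. g (e x)) ` {1..n}"
    then obtain x where x: "x \<in> {1..n}" "C = {z \<in> {1..n}. g (e z) = g (e x)}" by auto
    then have "C = pre n e {z \<in> {1..n}. g z = g (e x)}" "x \<in> C" using pre by auto
    with en[OF x(1)] show "C \<in> pre n e ` (\<lambda>y. {x \<in> {1..n}. g x = y}) ` g ` {1..n} - {{}}" by blast
  next
    fix C assume C: "C \<in> pre n e ` (\<lambda>y. {x \<in> {1..n}. g x = y}) ` g ` {1..n} - {{}}"
    then obtain y where y: "C = {x \<in> {1..n}. g (e x) = y}" using pre by auto
    with C obtain x where "x \<in> {1..n}" "g (e x) = y" by auto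
    with y show "C \<in> (\<lambda>y. {x \<in> {1..n}. g (e x) = y}) ` (\<lambda>x. g (e x)) ` {1..n}" by blast
  qed
qed

lemma pre_nonempty:
  assumes "pre n e ` P \<in> Part n r" "C \<in> P"
  shows "pre n e C \<noteq> {}"
  using assms by (auto simp: Part_def partition_on_def)

text \<open>Empty preimages are excluded by counting, since \<open>P\<close> and \<open>Q\<close> have the same number of
  classes.\<close>

lemma left_act_iff:
  assumes e: "e \<in> idems n" and P: "P \<in> Part n r" and Q: "Q \<in> Part n r"
  shows "left_act n r e P Q \<longleftrightarrow> Q = pre n e ` P"
proof
  assume "left_act n r e P Q"
  then obtain x A where x: "has_indices n r x P A" "has_indices n r (ig_mul n (gen n e) x) Q A"
    by (auto simp: left_act_def)
  from x(1) obtain w where w: "w \<in> ig_words n" "x = wcls n w" "P = ker n (act w)"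
    by (rule has_indicesD)
  from x(2) obtain v where v: "v \<in> ig_words n" "ig_mul n (gen n e) x = wcls n v"
    "Q = ker n (act v)"
    by (rule has_indicesD)
  have "wcls n v = wcls n ([e] @ w)"
    using v w ig_mul_wcls[OF gen_word[OF e] w(1)] by (simp add: gen_def)
  then have "ig_cong n v ([e] @ w)"
    using wcls_eq_iff v w append_ig_words gen_word[OF e] by blast
  then have "\<forall>x\<in>{1..n}. act v x = act w (e x)"
    using ig_cong_eval by (fastforce simp: act_append)
  then have Q': "Q = pre n e ` P - {{}}"
    using ker_cong[of n "act v" "\<lambda>x. act w (e x)"] ker_pre[OF e] v w by auto
  have "{} \<notin> pre n e ` P"
  proof
    assume "{} \<in> pre n e ` P"
    then have "card Q < card (pre n e ` P)"
      unfolding Q' using Part_finite[OF P] by (intro card_Diff1_less) auto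
    also have "\<dots> \<le> card P" by (rule card_image_le[OF Part_finite[OF P]])
    finally show False using P Q by (simp add: Part_def)
  qed
  with Q' show "Q = pre n e ` P" by blast
next
  assume eq: "Q = pre n e ` P"
  with Q have ne: "pre n e C \<noteq> {}" if "C \<in> P" for C using pre_nonempty that by metis
  obtain h where h: "h \<in> idems n" "ker n h = P" "\<And>x. x \<in> {1..n} \<Longrightarrow> e (h x) = h x"
    using idempotent_with_kernel[OF e _ ne] P by (auto simp: Part_def)
  have "tmul n h e = h" using h by (simp add: tmul_eq_iff)
  then have bp: "basic_pair n e h" using h e by (auto simp: basic_pair_def)
  have "ker n (tmul n e h) = pre n e ` P - {{}}"
    using ker_cong[of n "tmul n e h" "\<lambda>x. h (e x)"] ker_pre[OF e, of h] h by (simp add: tmul_apply)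
  then have ker: "ker n (tmul n e h) = Q" using ne eq by auto
  have "im n (tmul n e h) = im n h"
  proof
    show "im n (tmul n e h) \<subseteq> im n h" using e by (auto simp: im_def tmul_apply idems_iff)
    have "h x = tmul n e h (h x)" if "x \<in> {1..n}" for x
      using h that by (simp add: tmul_apply idems_iff)
    then show "im n h \<subseteq> im n (tmul n e h)" using h(1) by (fastforce simp: im_def idems_iff)
  qed
  moreover have "has_indices n r (gen n (tmul n e h)) (ker n (tmul n e h)) (im n (tmul n e h))"
    using basic_pair_tmul[OF bp] ker Q card_ker[of n "tmul n e h"]
    by (intro has_indices_gen) (auto simp: rank_def Part_def im_def)
  moreover have "has_indices n r (gen n h) (ker n h) (im n h)"
    using h P card_ker[of n h] by (intro has_indices_gen) (auto simp: rank_def Part_def im_def)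
  ultimately show "left_act n r e P Q"
    unfolding left_act_def using ker h(2) gen_mul[OF bp] by metis
qed

section \<open>Edge labels\<close>

lemma elt_bij:
  assumes "finite A" shows "bij_betw (elt A) {1..card A} A"
proof -
  have "bij_betw (\<lambda>i::nat. i - 1) {1..card A} {..<card A}"
    by (rule bij_betw_byWitness[where f' = Suc]) (auto simp: atLeastAtMost_iff)
  moreover have "bij_betw ((!) (sorted_list_of_set A)) {..<card A} A"
    using assms by (intro bij_betw_nth) auto
  ultimately have "bij_betw ((!) (sorted_list_of_set A) \<circ> (\<lambda>i. i - 1)) {1..card A} A"
    by (rule bij_betw_trans)
  then show ?thesis by (simp add: elt_def[abs_def] comp_def)
qed

lemma Lam_bij: "A \<in> Lam n m \<Longrightarrow> bij_betw (elt A) {1..m} A"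
  using elt_bij[OF Lam_finite] by (auto simp: Lam_def)

lemma Part_class: 
  assumes "P \<in> Part n r" "C \<in> P"
  shows "C \<noteq> {}" "C \<subseteq> {1..n}" "finite C"
proof -
  show "C \<noteq> {}" "C \<subseteq> {1..n}" using assms by (auto simp: Part_def partition_on_def)
  then show "finite C" by (meson finite_atLeastAtMost finite_subset)
qed

lemma Part_disjoint:
  assumes "P \<in> Part n r" "C \<in> P" "D \<in> P" "x \<in> C" "x \<in> D"
  shows "C = D"
  using assms by (auto simp: Part_def partition_on_def disjoint_def)

lemma Part_cover:
  assumes "P \<in> Part n r" "x \<in> {1..n}"
  obtains C where "C \<in> P" "x \<in> C"
  using assms by (auto simp: Part_def partition_on_def)

lemma Part_bij:
  assumes P: "P \<in> Part n r" shows "bij_betw (cls P) {1..r} P"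
proof -
  have "inj_on Min P"
    using Part_class[OF P] Part_disjoint[OF P] Min_in by (metis inj_onI)
  then have Min: "bij_betw Min P (Min ` P)" by (rule inj_on_imp_bij_betw)
  have "bij_betw (elt (Min ` P)) {1..card (Min ` P)} (Min ` P)"
    using Part_finite[OF P] by (intro elt_bij) simp
  moreover have "card (Min ` P) = r"
    using P bij_betw_same_card[OF Min] by (simp add: Part_def)
  ultimately have elt: "bij_betw (elt (Min ` P)) {1..r} (Min ` P)" by simp
  have "bij_betw (inv_into P Min \<circ> elt (Min ` P)) {1..r} P"
    by (rule bij_betw_trans[OF elt bij_betw_inv_into[OF Min]])
  moreover have "(inv_into P Min \<circ> elt (Min ` P)) i = cls P i" if "i \<in> {1..r}" for i
  proof -
    let ?C = "inv_into P Min (elt (Min ` P) i)"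
    have "elt (Min ` P) i \<in> Min ` P" using elt that by (auto simp: bij_betw_def)
    then have "?C \<in> P \<and> Min ?C = elt (Min ` P) i"
      using inv_into_into f_inv_into_f by metis
    then show ?thesis
      unfolding cls_def comp_def using \<open>inj_on Min P\<close>
      by (intro the_equality[symmetric]) (blast, metis inj_onD)
  qed
  ultimately show ?thesis by (simp cong: bij_betw_cong)
qed

lemma bij_betw_in: "bij_betw f S T \<Longrightarrow> x \<in> S \<Longrightarrow> f x \<in> T"
  by (auto simp: bij_betw_def)

lemma bij_betw_eq: "bij_betw f S T \<Longrightarrow> x \<in> S \<Longrightarrow> y \<in> S \<Longrightarrow> f x = f y \<longleftrightarrow> x = y"
  by (auto simp: bij_betw_def inj_on_def)

lemma bij_betw_obtain:
  assumes "bij_betw f S T" "y \<in> T" obtains x where "x \<in> S" "f x = y"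
  using assms by (auto simp: bij_betw_def)

lemma lam_spec:
  assumes A: "A \<in> Lam n m" and P: "P \<in> Part n m" and AP: "A \<bottom>\<bottom> P"
  shows "lam P A permutes {1..m}"
    and "\<And>i. i \<in> {1..m} \<Longrightarrow> elt A (lam P A i) \<in> cls P i"
proof -
  note eA = Lam_bij[OF A] and cP = Part_bij[OF P]
  have card: "card A = m" "card P = m" using A P by (auto simp: Lam_def Part_def)
  have lam: "lam P A i \<in> {1..m} \<and> elt A (lam P A i) \<in> cls P i" if i: "i \<in> {1..m}" for i
  proof -
    have "\<exists>!x. x \<in> A \<and> x \<in> cls P i" using AP bij_betw_in[OF cP i] by (simp add: perp_def)
    then have "\<exists>!k. k \<in> {1..m} \<and> elt A k \<in> cls P i"
      using bij_betw_obtain[OF eA] bij_betw_in[OF eA] bij_betw_eq[OF eA] by metis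
    from theI'[OF this] show ?thesis using i card by (simp add: lam_def)
  qed
  then show "\<And>i. i \<in> {1..m} \<Longrightarrow> elt A (lam P A i) \<in> cls P i" by blast
  have "inj_on (lam P A) {1..m}"
  proof (rule inj_onI)
    fix i j assume ij: "i \<in> {1..m}" "j \<in> {1..m}" "lam P A i = lam P A j"
    then have "cls P i = cls P j"
      using Part_disjoint[OF P] lam bij_betw_in[OF cP] by metis
    then show "i = j" using bij_betw_eq[OF cP] ij by blast
  qed
  moreover have "lam P A ` {1..m} \<subseteq> {1..m}" using lam by blast
  ultimately have "bij_betw (lam P A) {1..m} {1..m}"
    by (simp add: bij_betw_def endo_inj_surj)
  then show "lam P A permutes {1..m}"
    by (rule bij_imp_permutes) (simp add: lam_def card)
qed

text \<open>Each class \<open>C\<close> of \<open>P0\<close> is a union of kernel classes of \<open>e\<close> and \<open>e\<close> maps it into itself.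
  So \<open>e\<close> maps the element of \<open>B\<close> in \<open>C\<close> to the element of \<open>A\<close> in \<open>C\<close>, and the label does not
  depend on \<open>P0\<close>.\<close>

lemma transversal_label:
  assumes e: "e \<in> idems n" and A: "A \<in> Lam n m" and B: "B \<in> Lam n m" and AB: "A = e ` B"
    and P0: "P0 \<in> Part n m" "P0 = pre n e ` P0" "A \<bottom>\<bottom> P0" "B \<bottom>\<bottom> P0"
    and a: "a = inv (lam P0 A) \<circ>> lam P0 B"
  shows "a permutes {1..m}" "\<And>k. k \<in> {1..m} \<Longrightarrow> e (elt B (a k)) = elt A k"
proof -
  note lA = lam_spec[OF A P0(1,3)] and lB = lam_spec[OF B P0(1,4)]
  show perm: "a permutes {1..m}"
    unfolding a fcomp_comp by (rule permutes_compose[OF permutes_inv[OF lA(1)] lB(1)])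
  fix k assume k: "k \<in> {1..m}"
  define i where "i = inv (lam P0 A) k"
  have i: "i \<in> {1..m}" "lam P0 A i = k"
    using permutes_in_image[OF permutes_inv[OF lA(1)]] permutes_inverses[OF lA(1)] k
    by (auto simp: i_def)
  have "a k = lam P0 B i" by (simp add: a i_def)
  let ?y = "elt B (a k)"
  have yC: "?y \<in> cls P0 i" using lB(2)[OF i(1)] \<open>a k = lam P0 B i\<close> by simp
  have kC: "elt A k \<in> cls P0 i" using lA(2)[OF i(1)] i(2) by simp
  have C: "cls P0 i \<in> P0" by (rule bij_betw_in[OF Part_bij[OF P0(1)] i(1)])
  then obtain C' where C': "C' \<in> P0" "cls P0 i = pre n e C'" using P0(2) by auto
  have "e ?y \<in> cls P0 i" using yC e unfolding C' by (auto simp: pre_def idems_iff)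
  moreover have "e ?y \<in> A"
    using AB bij_betw_in[OF Lam_bij[OF B]] permutes_in_image[OF perm] k by blast
  moreover have "elt A k \<in> A" by (rule bij_betw_in[OF Lam_bij[OF A] k])
  ultimately show "e ?y = elt A k" using P0(3) C kC unfolding perp_def by blast
qed

text \<open>Dually, \<open>e\<close> fixes \<open>A0\<close> pointwise, so that an element of \<open>A0\<close> lies in a class of \<open>P\<close>
  exactly if it lies in its preimage under \<open>e\<close>.\<close>

lemma class_label:
  assumes e: "e \<in> idems n" and P: "P \<in> Part n r" and Q: "Q \<in> Part n r" and PQ: "Q = pre n e ` P"
    and A0: "A0 \<in> Lam n r" "A0 = e ` A0" "A0 \<bottom>\<bottom> P" "A0 \<bottom>\<bottom> Q"
    and b: "b = lam Q A0 \<circ>> inv (lam P A0)"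
  shows "inv b permutes {1..r}" "\<And>l. l \<in> {1..r} \<Longrightarrow> cls Q (inv b l) = pre n e (cls P l)"
proof -
  note lP = lam_spec[OF A0(1) P A0(3)] and lQ = lam_spec[OF A0(1) Q A0(4)]
  have perm: "b permutes {1..r}"
    unfolding b fcomp_comp by (rule permutes_compose[OF lQ(1) permutes_inv[OF lP(1)]])
  then show "inv b permutes {1..r}" by (rule permutes_inv)
  fix l assume l: "l \<in> {1..r}"
  define j where "j = inv b l"
  have j: "j \<in> {1..r}" "b j = l"
    using permutes_in_image[OF permutes_inv[OF perm]] permutes_inverses[OF perm] l
    by (auto simp: j_def)
  have "lam P A0 (b j) = lam Q A0 j"
    by (simp add: b permutes_inverses[OF lP(1)])
  then have eq: "lam P A0 l = lam Q A0 j" using j by simp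
  let ?y = "elt A0 (lam P A0 l)"
  have yA: "?y \<in> A0"
    using bij_betw_in[OF Lam_bij[OF A0(1)]] permutes_in_image[OF lP(1)] l by blast
  then have "?y \<in> e ` A0" using A0(2) by metis
  then obtain z where z: "z \<in> A0" "?y = e z" by (rule imageE)
  have "A0 \<subseteq> {1..n}" using A0(1) by (simp add: Lam_def)
  then have y: "?y \<in> {1..n}" "e ?y = ?y"
    using yA z(1) idems_idem[OF e, of z] unfolding z(2) by auto
  have "?y \<in> pre n e (cls P l)" using lP(2)[OF l] y by (simp add: pre_def)
  moreover have "?y \<in> cls Q j" using lQ(2)[OF j(1)] eq by simp
  moreover have "pre n e (cls P l) \<in> Q" using PQ bij_betw_in[OF Part_bij[OF P] l] by blast
  moreover have "cls Q j \<in> Q" by (rule bij_betw_in[OF Part_bij[OF Q] j(1)])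
  ultimately show "cls Q (inv b l) = pre n e (cls P l)"
    using Part_disjoint[OF Q] unfolding j_def by blast
qed

text \<open>The auxiliary partition \<open>P0\<close> and the auxiliary set \<open>A0\<close> of an edge exist: they are the
  kernel and the image of the idempotents constructed above.\<close>

lemma ex_transversal_partition:
  assumes e: "e \<in> idems n" and A: "A \<in> Lam n m" and B: "B \<in> Lam n m" and AB: "A = e ` B"
    and m: "0 < m"
  obtains P0 where "P0 \<in> Part n m" "P0 = pre n e ` P0" "A \<bottom>\<bottom> P0" "B \<bottom>\<bottom> P0"
proof -
  have inj: "inj_on e B" using im_inj A B AB by blast
  have Bn: "B \<subseteq> {1..n}" "B \<noteq> {}" using B m by (auto simp: Lam_def)
  obtain h where h: "h \<in> idems n" "im n h = B" "\<And>x. x \<in> {1..n} \<Longrightarrow> h (e x) = h x"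
    using idempotent_with_image[OF e Bn inj] by blast
  have hB: "h y = y" if "y \<in> B" for y using that h(1,2) by (auto simp: im_def idems_iff)
  have ker: "ker n h = (\<lambda>y. {x \<in> {1..n}. h x = y}) ` B"
    using h(2) by (simp add: ker_eq im_def)
  have "card (ker n h) = m" using card_ker[of n h] h(2) B by (simp add: im_def Lam_def)
  then have "ker n h \<in> Part n m" using partition_on_ker by (simp add: Part_def)
  moreover have "pre n e C = C" if "C \<in> ker n h" for C
    using that h(3) idems_in[OF e] by (auto simp: ker pre_def)
  then have "ker n h = pre n e ` ker n h" by simp
  moreover have "\<exists>!x. x \<in> A \<and> x \<in> {x \<in> {1..n}. h x = y}" if "y \<in> B" for y
    using that AB h(3) hB Bn idems_in[OF e] by (intro ex1I[of _ "e y"]) auto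
  then have "A \<bottom>\<bottom> ker n h" by (auto simp: perp_def ker)
  moreover have "\<exists>!x. x \<in> B \<and> x \<in> {x \<in> {1..n}. h x = y}" if "y \<in> B" for y
    using that hB Bn by (intro ex1I[of _ y]) auto
  then have "B \<bottom>\<bottom> ker n h" by (auto simp: perp_def ker)
  ultimately show thesis by (rule that)
qed

lemma ex_fixed_section:
  assumes e: "e \<in> idems n" and P: "P \<in> Part n r" and Q: "Q \<in> Part n r" and PQ: "Q = pre n e ` P"
  obtains A0 where "A0 \<in> Lam n r" "A0 = e ` A0" "A0 \<bottom>\<bottom> P" "A0 \<bottom>\<bottom> Q"
proof -
  have ne: "pre n e C \<noteq> {}" if "C \<in> P" for C using pre_nonempty Q PQ that by blast
  have "partition_on {1..n} P" using P by (simp add: Part_def)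
  then obtain h where h: "h \<in> idems n" "ker n h = P" "\<And>x. x \<in> {1..n} \<Longrightarrow> e (h x) = h x"
    using idempotent_with_kernel[OF e _ ne] by blast
  have im: "x \<in> {1..n} \<and> h x = x \<and> e x = x" if "x \<in> im n h" for x
    using that h by (auto simp: im_def idems_iff)
  have ker: "P = (\<lambda>y. {x \<in> {1..n}. h x = y}) ` im n h"
    using h(2) by (simp add: ker_eq im_def)
  have "card (im n h) = r" using card_ker[of n h] h(2) P by (simp add: im_def Part_def)
  then have "im n h \<in> Lam n r" using im by (auto simp: Lam_def)
  moreover have "im n h = e ` im n h" using im by force
  moreover have "\<exists>!x. x \<in> im n h \<and> x \<in> {x \<in> {1..n}. h x = y}" if "y \<in> im n h" for y
    using that im by (intro ex1I[of _ y]) auto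
  then have perp: "im n h \<bottom>\<bottom> P" by (auto simp: perp_def ker)
  moreover have "x \<in> im n h \<and> x \<in> pre n e C \<longleftrightarrow> x \<in> im n h \<and> x \<in> C" for x C
    using im by (auto simp: pre_def)
  then have "im n h \<bottom>\<bottom> Q" using perp unfolding PQ perp_def by simp
  ultimately show thesis by (rule that)
qed

lemma permutes_eqI:
  assumes "a permutes S" "a' permutes S" "\<And>k. k \<in> S \<Longrightarrow> a k = a' k"
  shows "a = a'"
  using assms by (metis ext permutes_not_in)

text \<open>The concrete form of the contact graph, without the auxiliary transversals.  A label
  stands for the enumeration \<open>k \<mapsto> elt B (a k)\<close> of \<open>B\<close> and a similar one of \<open>Q\<close>, and an edge is
  given by an idempotent that respects these enumerations.  Since \<open>e\<close> is injective on \<open>B\<close> and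
  taking preimages is injective on \<open>P\<close>, the label is determined by \<open>e\<close> and the two vertices.\<close>

lemma edge_iff:
  assumes AP: "(A, P) \<in> vertices n m r" and BQ: "(B, Q) \<in> vertices n m r"
    and m: "0 < m" and r: "0 < r"
  shows "edge n m r (A, P) (a, c) (B, Q) \<longleftrightarrow>
    a permutes {1..m} \<and> c permutes {1..r} \<and>
    (\<exists>e\<in>idems n. (\<forall>k\<in>{1..m}. e (elt B (a k)) = elt A k) \<and>
       (\<forall>l\<in>{1..r}. cls Q (c l) = pre n e (cls P l)))"
    (is "?L \<longleftrightarrow> ?R")
proof -
  have A: "A \<in> Lam n m" and B: "B \<in> Lam n m" and P: "P \<in> Part n r" and Q: "Q \<in> Part n r"
    using AP BQ by (auto simp: vertices_def)
  show ?thesis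
  proof
    assume ?L
    then show ?R
    proof cases
      case (1 e P0 A0 b)
      have "A = e ` B" using 1 right_act_iff[OF _ A B m] by blast
      moreover have "P0 = pre n e ` P0" using 1 left_act_iff by blast
      ultimately have a: "a permutes {1..m}" "\<forall>k\<in>{1..m}. e (elt B (a k)) = elt A k"
        using transversal_label[OF _ A B] 1 by blast+
      have "A0 = e ` A0" using 1 right_act_iff r by blast
      moreover have "Q = pre n e ` P" using 1 left_act_iff[OF _ P Q] by blast
      ultimately have "inv b permutes {1..r}" "\<forall>l\<in>{1..r}. cls Q (inv b l) = pre n e (cls P l)"
        using class_label[OF _ P Q] 1 by blast+
      with a 1 show ?R by blast
    qed
  next
    assume ?R
    then obtain e where a: "a permutes {1..m}" and c: "c permutes {1..r}" and e: "e \<in> idems n"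
      and ea: "\<And>k. k \<in> {1..m} \<Longrightarrow> e (elt B (a k)) = elt A k"
      and ec: "\<And>l. l \<in> {1..r} \<Longrightarrow> cls Q (c l) = pre n e (cls P l)" by blast
    have "bij_betw (elt B \<circ> a) {1..m} B"
      by (rule bij_betw_trans[OF permutes_imp_bij[OF a] Lam_bij[OF B]])
    then have "e ` B = e ` (elt B \<circ> a) ` {1..m}" by (simp add: bij_betw_def)
    also have "\<dots> = elt A ` {1..m}" unfolding image_image using ea by (intro image_cong) auto
    also have "\<dots> = A" using Lam_bij[OF A] by (simp add: bij_betw_def)
    finally have AB: "A = e ` B" by simp
    have "bij_betw (cls Q \<circ> c) {1..r} Q"
      by (rule bij_betw_trans[OF permutes_imp_bij[OF c] Part_bij[OF Q]])
    then have "Q = (cls Q \<circ> c) ` {1..r}" by (simp add: bij_betw_def)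
    also have "\<dots> = pre n e ` cls P ` {1..r}" unfolding image_image using ec by (intro image_cong) auto
    also have "cls P ` {1..r} = P" using Part_bij[OF P] by (simp add: bij_betw_def)
    finally have PQ: "Q = pre n e ` P" .
    obtain P0 where P0: "P0 \<in> Part n m" "P0 = pre n e ` P0" "A \<bottom>\<bottom> P0" "B \<bottom>\<bottom> P0"
      by (rule ex_transversal_partition[OF e A B AB m])
    obtain A0 where A0: "A0 \<in> Lam n r" "A0 = e ` A0" "A0 \<bottom>\<bottom> P" "A0 \<bottom>\<bottom> Q"
      by (rule ex_fixed_section[OF e P Q PQ])
    have inj: "inj_on e B" using im_inj A B AB by blast
    note la = transversal_label[OF e A B AB P0 HOL.refl] and lc = class_label[OF e P Q PQ A0 HOL.refl]
    have aeq: "a = inv (lam P0 A) \<circ>> lam P0 B" (is "_ = ?a")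
    proof (rule permutes_eqI[OF a la(1)])
      fix k assume k: "k \<in> {1..m}"
      then have "a k \<in> {1..m}" "?a k \<in> {1..m}"
        using permutes_in_image[OF a] permutes_in_image[OF la(1)] by auto
      moreover have "e (elt B (a k)) = e (elt B (?a k))" using ea la(2) k by simp
      ultimately show "a k = ?a k"
        using bij_betw_in[OF Lam_bij[OF B]] bij_betw_eq[OF Lam_bij[OF B]] inj by (meson inj_onD)
    qed
    have ceq: "c = inv (lam Q A0 \<circ>> inv (lam P A0))" (is "_ = ?c")
    proof (rule permutes_eqI[OF c lc(1)])
      fix l assume l: "l \<in> {1..r}"
      then have "c l \<in> {1..r}" "?c l \<in> {1..r}"
        using permutes_in_image[OF c] permutes_in_image[OF lc(1)] by auto
      moreover have "cls Q (c l) = cls Q (?c l)" using ec lc(2) l by simp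
      ultimately show "c l = ?c l" using bij_betw_eq[OF Part_bij[OF Q]] by blast
    qed
    show ?L
      unfolding aeq ceq using e A B P Q AB PQ P0 A0 m r AP BQ
      by (intro edge.intros[OF AP BQ e]) (auto simp: right_act_iff left_act_iff)
  qed
qed

section \<open>Walk labels preserve incidence\<close>

text \<open>Auto-homeomorphisms, extended to isomorphisms between different vertices, so that they can
  be composed along a walk.\<close>

definition homeo :: "nat \<Rightarrow> nat \<Rightarrow> vertex \<Rightarrow> label \<Rightarrow> vertex \<Rightarrow> bool" where
  "homeo m r u g v \<longleftrightarrow> fst g permutes {1..m} \<and> snd g permutes {1..r} \<and>
     (\<forall>i\<in>{1..m}. \<forall>j\<in>{1..r}. elt (fst u) i \<in> cls (snd u) j \<longleftrightarrow>
        elt (fst v) (fst g i) \<in> cls (snd v) (snd g j))"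

lemma homeo_id: "homeo m r u (id, id) u"
  by (simp add: homeo_def permutes_id)

lemma homeo_mul:
  assumes "homeo m r u g v" "homeo m r v h w"
  shows "homeo m r u (label_mul g h) w"
  using assms permutes_in_image[of "fst g"] permutes_in_image[of "snd g"]
  unfolding homeo_def label_mul_def fcomp_comp by (auto intro: permutes_compose)

lemma homeo_inv:
  assumes "homeo m r u g v"
  shows "homeo m r v (label_inv g) u"
proof -
  from assms have g: "fst g permutes {1..m}" "snd g permutes {1..r}"
    and inc: "\<And>i j. i \<in> {1..m} \<Longrightarrow> j \<in> {1..r} \<Longrightarrow> elt (fst u) i \<in> cls (snd u) j \<longleftrightarrow>
        elt (fst v) (fst g i) \<in> cls (snd v) (snd g j)"
    by (auto simp: homeo_def)
  have "elt (fst v) i \<in> cls (snd v) j \<longleftrightarrow> elt (fst u) (inv (fst g) i) \<in> cls (snd u) (inv (snd g) j)"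
    if "i \<in> {1..m}" "j \<in> {1..r}" for i j
    using that inc[of "inv (fst g) i" "inv (snd g) j"] permutes_inverses[OF g(1)]
      permutes_inverses[OF g(2)] permutes_in_image[OF permutes_inv[OF g(1)]]
      permutes_in_image[OF permutes_inv[OF g(2)]] by simp
  with g show ?thesis by (simp add: homeo_def label_inv_def permutes_inv)
qed

lemma edge_vertices:
  assumes "edge n m r u l v" shows "u \<in> vertices n m r" "v \<in> vertices n m r"
  using assms by (auto elim: edge.cases)

text \<open>\<open>elt A i\<close> is the image under \<open>e\<close> of \<open>elt B (a i)\<close>, and it lies in a class of \<open>P\<close> exactly
  if \<open>elt B (a i)\<close> lies in the preimage of that class.\<close>

lemma edge_homeo:
  assumes "edge n m r u l v" "0 < m" "0 < r"
  shows "homeo m r u l v"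
proof -
  obtain A P a c B Q where [simp]: "u = (A, P)" "l = (a, c)" "v = (B, Q)" by (metis surj_pair)
  obtain e where a: "a permutes {1..m}" and c: "c permutes {1..r}" and e: "e \<in> idems n"
    and ea: "\<And>k. k \<in> {1..m} \<Longrightarrow> e (elt B (a k)) = elt A k"
    and ec: "\<And>l. l \<in> {1..r} \<Longrightarrow> cls Q (c l) = pre n e (cls P l)"
    using edge_iff[of A P n m r B Q a c] edge_vertices[OF assms(1)] assms by auto
  have B: "B \<in> Lam n m" using edge_vertices[OF assms(1)] by (simp add: vertices_def)
  have "elt B (a i) \<in> {1..n}" if "i \<in> {1..m}" for i
    using bij_betw_in[OF Lam_bij[OF B]] permutes_in_image[OF a] that B by (auto simp: Lam_def)
  then show ?thesis using a c ea ec by (auto simp: homeo_def pre_def)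
qed

lemma walk_vertex: "walk n m r u g v \<Longrightarrow> v \<in> vertices n m r"
  by (induction rule: walk.induct) (auto dest: edge_vertices)

lemma walk_homeo:
  assumes "walk n m r u g v" "0 < m" "0 < r"
  shows "homeo m r u g v"
  using assms by (induction rule: walk.induct) (auto intro: homeo_id homeo_mul homeo_inv edge_homeo)

lemma AHom_homeo:
  assumes "(A, P) \<in> vertices n m r"
  shows "AHom A P = {g. homeo m r (A, P) g (A, P)}"
proof -
  have "card A = m" "card P = r" using assms by (auto simp: vertices_def Lam_def Part_def)
  then show ?thesis by (auto simp: AHom_def homeo_def)
qed

section \<open>Stationary vertices are isolated\<close>

text \<open>Suppose that \<open>e\<close> moves \<open>x\<close>.  Then \<open>x\<close> is not in the image of \<open>e\<close>, hence not in \<open>A\<close>, and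
  its class in \<open>P\<close> must contain a point of the image, so it is not a singleton: \<open>(A, P)\<close> is not
  stationary.  Moreover \<open>x\<close> and \<open>e x\<close> lie in the same class of \<open>Q\<close> but not both in \<open>B\<close>, on which
  \<open>e\<close> is injective: \<open>(B, Q)\<close> is not stationary either.\<close>

lemma stationary_edge:
  assumes edge: "edge n m r (A, P) (a, c) (B, Q)" and mr: "0 < m" "0 < r"
    and st: "stationary A P \<or> stationary B Q"
  shows "(A, P) = (B, Q) \<and> a = id \<and> c = id"
proof -
  note V = edge_vertices[OF edge]
  then have A: "A \<in> Lam n m" and B: "B \<in> Lam n m" and P: "P \<in> Part n r" and Q: "Q \<in> Part n r"
    by (auto simp: vertices_def)
  obtain e where a: "a permutes {1..m}" and c: "c permutes {1..r}" and e: "e \<in> idems n"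
    and ea: "\<And>k. k \<in> {1..m} \<Longrightarrow> e (elt B (a k)) = elt A k"
    and ec: "\<And>l. l \<in> {1..r} \<Longrightarrow> cls Q (c l) = pre n e (cls P l)"
    using iffD1[OF edge_iff[OF V mr] edge] by blast
  have eB: "bij_betw (elt B \<circ> a) {1..m} B"
    by (rule bij_betw_trans[OF permutes_imp_bij[OF a] Lam_bij[OF B]])
  have cQ: "bij_betw (cls Q \<circ> c) {1..r} Q"
    by (rule bij_betw_trans[OF permutes_imp_bij[OF c] Part_bij[OF Q]])
  have Bn: "B \<subseteq> {1..n}" using B by (simp add: Lam_def)
  have fixed: "e x = x" if x: "x \<in> {1..n}" for x
  proof (rule ccontr)
    assume neq: "e x \<noteq> x"
    have notim: "e y \<noteq> x" if "y \<in> {1..n}" for y using neq idems_idem[OF e that] by metis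
    from st show False
    proof
      assume st: "stationary A P"
      have "x \<notin> A"
      proof
        assume "x \<in> A"
        then obtain k where k: "k \<in> {1..m}" "elt A k = x" by (rule bij_betw_obtain[OF Lam_bij[OF A]])
        then have "elt B (a k) \<in> B" using bij_betw_in[OF eB] by simp
        with k ea Bn notim show False by blast
      qed
      moreover obtain C where C: "C \<in> P" "x \<in> C" using Part_cover[OF P x] .
      ultimately have "is_singleton C" using st by (auto simp: stationary_def)
      with C have Cx: "C = {x}" by (auto simp: is_singleton_def)
      obtain l where l: "l \<in> {1..r}" "cls P l = C" using bij_betw_obtain[OF Part_bij[OF P] C(1)] .
      have "cls Q (c l) \<noteq> {}" using bij_betw_in[OF cQ l(1)] Part_class[OF Q] by auto
      with ec[OF l(1)] l(2) Cx notim show False by (auto simp: pre_def)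
    next
      assume st: "stationary B Q"
      obtain D where D: "D \<in> Q" "x \<in> D" using Part_cover[OF Q x] .
      obtain l where l: "l \<in> {1..r}" "(cls Q \<circ> c) l = D" using bij_betw_obtain[OF cQ D(1)] .
      then have "D = pre n e (cls P l)" using ec by simp
      then have exD: "e x \<in> D" using D(2) e by (auto simp: pre_def idems_iff)
      with D(2) neq have "\<not> is_singleton D" by (auto simp: is_singleton_def)
      with st D(1) have "D \<subseteq> B" by (auto simp: stationary_def)
      with exD D(2) have xB: "x \<in> B" "e x \<in> B" by auto
      from xB(1) obtain i where i: "i \<in> {1..m}" "(elt B \<circ> a) i = x" by (rule bij_betw_obtain[OF eB])
      from xB(2) obtain j where j: "j \<in> {1..m}" "(elt B \<circ> a) j = e x" by (rule bij_betw_obtain[OF eB])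
      have "elt A i = elt A j"
        using ea[OF i(1)] ea[OF j(1)] i(2) j(2) idems_idem[OF e x] by simp
      then have "i = j" using bij_betw_eq[OF Lam_bij[OF A]] i j by blast
      with i j neq show False by simp
    qed
  qed
  have ab: "elt B (a k) = elt A k" if "k \<in> {1..m}" for k
    using fixed[of "elt B (a k)"] ea[OF that] bij_betw_in[OF eB that] Bn by auto
  have "pre n e (cls P l) = cls P l" if "l \<in> {1..r}" for l
    using fixed Part_class(2)[OF P bij_betw_in[OF Part_bij[OF P] that]] by (auto simp: pre_def)
  then have cd: "cls Q (c l) = cls P l" if "l \<in> {1..r}" for l using ec that by simp
  have "A = (\<lambda>k. elt B (a k)) ` {1..m}"
    using Lam_bij[OF A] ab by (simp add: bij_betw_def)
  also have "\<dots> = B" using eB by (simp add: bij_betw_def comp_def)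
  finally have AB: "A = B" .
  have "P = (\<lambda>l. cls Q (c l)) ` {1..r}"
    using Part_bij[OF P] cd by (simp add: bij_betw_def)
  also have "\<dots> = Q" using cQ by (simp add: bij_betw_def comp_def)
  finally have PQ: "P = Q" .
  have "a = id"
  proof (rule permutes_eqI[OF a permutes_id])
    fix k assume k: "k \<in> {1..m}"
    then show "a k = id k"
      using ab[OF k] bij_betw_eq[OF Lam_bij[OF B]] permutes_in_image[OF a] AB by auto
  qed
  moreover have "c = id"
  proof (rule permutes_eqI[OF c permutes_id])
    fix l assume l: "l \<in> {1..r}"
    then show "c l = id l"
      using cd[OF l] bij_betw_eq[OF Part_bij[OF Q]] permutes_in_image[OF c] PQ by auto
  qed
  ultimately show ?thesis using AB PQ by simp
qed

lemma stationary_walk: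
  assumes "walk n m r u g v" "0 < m" "0 < r" "stationary (fst u) (snd u)"
  shows "v = u \<and> g = (id, id)"
  using assms
proof (induction rule: walk.induct)
  case (forward u g v l w)
  then have "v = u" "g = (id, id)" by auto
  with forward have "w = v \<and> l = (id, id)"
    by (cases v; cases w; cases l) (auto dest: stationary_edge)
  with \<open>v = u\<close> \<open>g = (id, id)\<close> show ?case by (simp add: label_mul_def fun_eq_iff)
next
  case (backward u g v w l)
  then have "v = u" "g = (id, id)" by auto
  with backward have "w = v \<and> l = (id, id)"
    by (cases v; cases w; cases l) (auto dest: stationary_edge)
  with \<open>v = u\<close> \<open>g = (id, id)\<close> show ?case by (simp add: label_mul_def label_inv_def fun_eq_iff)
qed simp

section \<open>Tokens on coloured positions\<close>

text \<open>A set \<open>M\<close> of tokens sits on the positions \<open>\<alpha> ` M\<close> in a set \<open>N\<close>, and \<open>\<beta>\<close> colours \<open>N\<close>.  Only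
  the values on \<open>M\<close> and \<open>N\<close> matter, which is the purpose of the rule \<open>same\<close>.  Both moves keep
  the colour of the position below each token and the set of all colours.\<close>

inductive reachable ::
  "'p set \<Rightarrow> 't set \<Rightarrow> ('t \<Rightarrow> 'p) \<Rightarrow> ('p \<Rightarrow> 'c) \<Rightarrow> ('t \<Rightarrow> 'p) \<Rightarrow> ('p \<Rightarrow> 'c) \<Rightarrow> bool"
  for N M \<alpha>0 \<beta>0 where
  start: "reachable N M \<alpha>0 \<beta>0 \<alpha>0 \<beta>0"
| same: "reachable N M \<alpha>0 \<beta>0 \<alpha> \<beta> \<Longrightarrow> (\<And>k. k \<in> M \<Longrightarrow> \<alpha>' k = \<alpha> k) \<Longrightarrow> (\<And>x. x \<in> N \<Longrightarrow> \<beta>' x = \<beta> x)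
    \<Longrightarrow> reachable N M \<alpha>0 \<beta>0 \<alpha>' \<beta>'"
| recolour: "reachable N M \<alpha>0 \<beta>0 \<alpha> \<beta> \<Longrightarrow> x \<in> N - \<alpha> ` M \<Longrightarrow> c \<in> \<beta> ` N \<Longrightarrow> \<beta>(x := c) ` N = \<beta> ` N
    \<Longrightarrow> reachable N M \<alpha>0 \<beta>0 \<alpha> (\<beta>(x := c))"
| jump: "reachable N M \<alpha>0 \<beta>0 \<alpha> \<beta> \<Longrightarrow> k \<in> M \<Longrightarrow> x \<in> N - \<alpha> ` M \<Longrightarrow> \<beta> x = \<beta> (\<alpha> k)
    \<Longrightarrow> reachable N M \<alpha>0 \<beta>0 (\<alpha>(k := x)) \<beta>"

text \<open>Free positions can be recoloured one after the other if all colours occur on the remaining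
  positions.\<close>

lemma reachable_recolour_set:
  assumes "reachable N M \<alpha>0 \<beta>0 \<alpha> \<beta>" "finite D" "D \<subseteq> N - \<alpha> ` M"
    and "\<beta> ` (N - D) = \<beta> ` N" "f ` D \<subseteq> \<beta> ` N"
  shows "reachable N M \<alpha>0 \<beta>0 \<alpha> (override_on \<beta> f D)"
  using assms(2-)
proof (induction D rule: finite_induct)
  case empty
  then show ?case using assms(1) by simp
next
  case (insert x D)
  let ?\<beta> = "override_on \<beta> f D"
  have D: "\<beta> ` (N - D) = \<beta> ` N" using insert.prems by blast
  have im: "?\<beta> ` N = \<beta> ` N"
  proof
    show "?\<beta> ` N \<subseteq> \<beta> ` N" using insert.prems by (auto simp: override_on_def)
    have "\<beta> ` (N - D) \<subseteq> ?\<beta> ` N" by (auto simp: override_on_def)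
    then show "\<beta> ` N \<subseteq> ?\<beta> ` N" using D by simp
  qed
  have "\<beta> ` (N - insert x D) \<subseteq> ?\<beta>(x := f x) ` N" by (auto simp: override_on_def)
  then have "\<beta> ` N \<subseteq> ?\<beta>(x := f x) ` N" using insert.prems by simp
  moreover have "?\<beta>(x := f x) ` N \<subseteq> \<beta> ` N"
    using insert.prems by (auto simp: override_on_def)
  ultimately have "?\<beta>(x := f x) ` N = ?\<beta> ` N" unfolding im by (rule equalityI[rotated])
  moreover have "reachable N M \<alpha>0 \<beta>0 \<alpha> ?\<beta>" using insert D by simp
  ultimately have "reachable N M \<alpha>0 \<beta>0 \<alpha> (?\<beta>(x := f x))"
    using insert.prems im by (intro reachable.recolour) auto
  then show ?case by (simp only: override_on_insert)
qed

text \<open>The sliding puzzle on a complete graph: the pieces \<open>T\<close> lie on distinct positions, at least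
  one position is empty, and any piece may move to any empty position.  If the destination of a
  misplaced piece is empty, move it there.  Otherwise the occupied positions are already the
  right ones; moving a misplaced piece out of the way vacates the destination of another
  misplaced piece.\<close>

lemma injections_connected:
  assumes step: "\<And>\<gamma> t x. \<lbrakk>Z \<gamma>; inj_on \<gamma> T; \<gamma> ` T \<subseteq> N; t \<in> T; x \<in> N - \<gamma> ` T\<rbrakk> \<Longrightarrow> Z (\<gamma>(t := x))"
    and N: "finite N" and T: "card T < card N" "finite T"
    and \<gamma>': "inj_on \<gamma>' T" "\<gamma>' ` T \<subseteq> N"
    and \<gamma>: "Z \<gamma>" "inj_on \<gamma> T" "\<gamma> ` T \<subseteq> N"
  shows "\<exists>\<delta>. Z \<delta> \<and> (\<forall>t\<in>T. \<delta> t = \<gamma>' t)"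
  using \<gamma>
proof (induction "card {t \<in> T. \<gamma> t \<noteq> \<gamma>' t}" arbitrary: \<gamma> rule: less_induct)
  case less
  have settle: ?case
    if \<delta>: "Z \<delta>" "inj_on \<delta> T" "\<delta> ` T \<subseteq> N" and t: "t \<in> T" "\<delta> t \<noteq> \<gamma>' t" "\<gamma>' t \<notin> \<delta> ` T"
      and le: "{t \<in> T. \<delta> t \<noteq> \<gamma>' t} \<subseteq> {t \<in> T. \<gamma> t \<noteq> \<gamma>' t}" for \<delta> t
  proof -
    let ?\<delta> = "\<delta>(t := \<gamma>' t)"
    have "{s \<in> T. ?\<delta> s \<noteq> \<gamma>' s} \<subset> {s \<in> T. \<delta> s \<noteq> \<gamma>' s}" using t by auto
    with le have "card {s \<in> T. ?\<delta> s \<noteq> \<gamma>' s} < card {t \<in> T. \<gamma> t \<noteq> \<gamma>' t}"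
      using T(2) by (intro psubset_card_mono) auto
    moreover have "Z ?\<delta>" using \<gamma>' t \<delta> by (intro step) auto
    moreover have "inj_on ?\<delta> T" using \<delta>(2) t(3) by (rule inj_on_fun_updI)
    moreover have "?\<delta> ` T \<subseteq> N" using \<delta> t \<gamma>' by auto
    ultimately show ?thesis by (rule less.hyps)
  qed
  show ?case
  proof (cases "\<exists>t\<in>T. \<gamma> t \<noteq> \<gamma>' t \<and> \<gamma>' t \<notin> \<gamma> ` T")
    case True
    then show ?thesis using settle less.prems by blast
  next
    case False
    show ?thesis
    proof (cases "\<forall>t\<in>T. \<gamma> t = \<gamma>' t")
      case True
      then show ?thesis using less.prems by blast
    next
      case neq: False
      then obtain t where t: "t \<in> T" "\<gamma> t \<noteq> \<gamma>' t" by blast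
      have "\<gamma>' s \<in> \<gamma> ` T" if "s \<in> T" for s
        using False that by (cases "\<gamma> s = \<gamma>' s") (auto intro: rev_image_eqI)
      then have "\<gamma>' ` T \<subseteq> \<gamma> ` T" by blast
      then have "\<gamma>' ` T = \<gamma> ` T"
        using T(2) card_image[OF \<gamma>'(1)] card_image[OF less.prems(2)] by (intro card_subset_eq) auto
      then obtain s where s: "s \<in> T" "\<gamma>' s = \<gamma> t" using t by (metis imageE imageI)
      have "s \<noteq> t" using s t by auto
      then have st: "\<gamma> s \<noteq> \<gamma> t" using less.prems(2) s t by (auto dest: inj_onD)
      have "card (\<gamma> ` T) < card N" using card_image[OF less.prems(2)] T by simp
      then obtain x where x: "x \<in> N - \<gamma> ` T"
        by (metis DiffI card_mono finite_imageI T(2) linorder_not_less subsetI)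
      let ?\<delta> = "\<gamma>(t := x)"
      show ?thesis
      proof (rule settle[of ?\<delta> s])
        show "Z ?\<delta>" using step[OF less.prems t(1) x] .
        show "inj_on ?\<delta> T" using less.prems(2) x by (simp add: inj_on_fun_updI)
        show "?\<delta> ` T \<subseteq> N" using less.prems(3) x by auto
        show "s \<in> T" by (rule s(1))
        show "?\<delta> s \<noteq> \<gamma>' s" using \<open>s \<noteq> t\<close> st s by simp
        show "\<gamma>' s \<notin> ?\<delta> ` T" using s t x less.prems(2) by (auto dest: inj_onD)
        show "{t \<in> T. ?\<delta> t \<noteq> \<gamma>' t} \<subseteq> {t \<in> T. \<gamma> t \<noteq> \<gamma>' t}" using t by auto
      qed
    qed
  qed
qed

text \<open>The pieces of the sliding puzzle are the elements of a set \<open>T\<close> of positions: those that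
  initially carry a token, together with one representative \<open>\<rho> c\<close> of every colour \<open>c\<close> without
  token.  All colours occur on \<open>T\<close>.  An injection \<open>\<gamma>\<close> of \<open>T\<close> into the positions describes every
  configuration with tokens at \<open>\<gamma> \<circ> \<alpha>\<close> in which the piece \<open>t\<close> lies on a position with the colour
  \<open>\<beta> t\<close> that \<open>t\<close> had initially; colours outside \<open>\<gamma> ` T\<close> are arbitrary.  The invariant \<open>Z \<gamma>\<close> says
  that all these configurations are reachable.\<close>

lemma puzzle_connected:
  assumes N: "finite N" and \<alpha>: "inj_on \<alpha> M" "\<alpha> ` M \<subseteq> N" and \<alpha>': "inj_on \<alpha>' M" "\<alpha>' ` M \<subseteq> N"
    and im: "\<beta>' ` N = \<beta> ` N" and eq: "\<And>k. k \<in> M \<Longrightarrow> \<beta>' (\<alpha>' k) = \<beta> (\<alpha> k)"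
    and x: "x \<in> N - \<alpha> ` M" and y: "y \<in> N" "y \<noteq> x" "\<beta> y = \<beta> x"
  shows "reachable N M \<alpha> \<beta> \<alpha>' \<beta>'"
proof -
  (* the colours without token *)
  define U where "U = \<beta> ` N - \<beta> ` \<alpha> ` M"
  (* A representative equal to x can be replaced by y, so that x stays empty. *)
  have "\<exists>z. z \<in> N - {x} \<and> \<beta> z = c" if "c \<in> U" for c
    using that y by (metis DiffD1 DiffI U_def imageE insertE empty_iff)
  then obtain \<rho> where \<rho>: "\<And>c. c \<in> U \<Longrightarrow> \<rho> c \<in> N - {x} \<and> \<beta> (\<rho> c) = c" by metis
  have "\<exists>z. z \<in> N \<and> \<beta>' z = c" if "c \<in> U" for c
    using that im unfolding U_def by (metis DiffD1 imageE)
  then obtain \<rho>' where \<rho>': "\<And>c. c \<in> U \<Longrightarrow> \<rho>' c \<in> N \<and> \<beta>' (\<rho>' c) = c" by metis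
  define T where "T = \<alpha> ` M \<union> \<rho> ` U"
  have TN: "T \<subseteq> N" and xT: "x \<in> N - T" using \<alpha> \<rho> x by (auto simp: T_def)
  then have finT: "finite T" and cardT: "card T < card N"
    using N finite_subset by (auto intro!: psubset_card_mono)
  have colours: "\<beta> ` T = \<beta> ` N"
  proof
    show "\<beta> ` N \<subseteq> \<beta> ` T"
    proof
      fix c assume c: "c \<in> \<beta> ` N"
      show "c \<in> \<beta> ` T"
      proof (cases "c \<in> U")
        case True
        then have "c = \<beta> (\<rho> c)" "\<rho> c \<in> T" using \<rho> by (auto simp: T_def)
        then show ?thesis by (rule image_eqI)
      next
        case False
        with c show ?thesis by (auto simp: U_def T_def)
      qed
    qed
  qed (use TN in blast)
  define Z where "Z \<gamma> \<longleftrightarrow> (\<forall>\<beta>1. \<beta>1 ` N \<subseteq> \<beta> ` N \<longrightarrow> (\<forall>t\<in>T. \<beta>1 (\<gamma> t) = \<beta> t) \<longrightarrow>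
    reachable N M \<alpha> \<beta> (\<gamma> \<circ> \<alpha>) \<beta>1)" for \<gamma>
  have "Z id"
    unfolding Z_def
  proof (intro allI impI)
    fix \<beta>1 assume \<beta>1: "\<beta>1 ` N \<subseteq> \<beta> ` N" "\<forall>t\<in>T. \<beta>1 (id t) = \<beta> t"
    have "N - (N - T) = T" using TN by blast
    then have "reachable N M \<alpha> \<beta> \<alpha> (override_on \<beta> \<beta>1 (N - T))"
      using N colours \<beta>1(1) TN
      by (intro reachable_recolour_set reachable.start) (auto simp: T_def)
    then show "reachable N M \<alpha> \<beta> (id \<circ> \<alpha>) \<beta>1"
      by (rule reachable.same) (use \<beta>1 in \<open>auto simp: override_on_def\<close>)
  qed
  have step: "Z (\<gamma>(t := z))"
    if Z: "Z \<gamma>" and \<gamma>: "inj_on \<gamma> T" "\<gamma> ` T \<subseteq> N" and t: "t \<in> T" and z: "z \<in> N - \<gamma> ` T" for \<gamma> t z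
    unfolding Z_def
  proof (intro allI impI)
    fix \<beta>2 assume \<beta>2: "\<beta>2 ` N \<subseteq> \<beta> ` N" "\<forall>s\<in>T. \<beta>2 ((\<gamma>(t := z)) s) = \<beta> s"
    (* The empty position z gets the colour of the piece t first.  Once the piece has moved, its
       old position is empty, and its colour can be corrected. *)
    define \<beta>1 where "\<beta>1 = \<beta>2(\<gamma> t := \<beta> t)"
    have supp: "\<beta>1 (\<gamma> s) = \<beta> s" if "s \<in> T" for s
    proof (cases "s = t")
      case False
      then have "\<gamma> s \<noteq> \<gamma> t" using \<gamma>(1) that t by (auto dest: inj_onD)
      then show ?thesis using \<beta>2(2) that False by (auto simp: \<beta>1_def)
    qed (simp add: \<beta>1_def)
    have b1z: "\<beta>1 z = \<beta> t" using \<beta>2(2) t z by (auto simp: \<beta>1_def)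
    have "\<beta>1 ` N \<subseteq> \<beta> ` N" using \<beta>2(1) t TN by (auto simp: \<beta>1_def)
    then have R1: "reachable N M \<alpha> \<beta> (\<gamma> \<circ> \<alpha>) \<beta>1" using Z supp by (simp add: Z_def)
    have im1: "\<beta>1 ` N = \<beta> ` N"
    proof
      have "\<beta> ` T \<subseteq> \<beta>1 ` N" using supp \<gamma>(2) by (force simp: image_iff)
      then show "\<beta> ` N \<subseteq> \<beta>1 ` N" using colours by simp
    qed fact
    have im2: "\<beta>2 ` N = \<beta> ` N"
    proof
      have "(\<gamma>(t := z)) s \<in> N" if "s \<in> T" for s using that \<gamma>(2) z by auto
      then have "\<beta> ` T \<subseteq> \<beta>2 ` N" using \<beta>2(2) by (metis image_eqI image_subsetI)
      then show "\<beta> ` N \<subseteq> \<beta>2 ` N" using colours by simp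
    qed fact
    have R2: "reachable N M \<alpha> \<beta> (\<gamma>(t := z) \<circ> \<alpha>) \<beta>1"
    proof (cases "t \<in> \<alpha> ` M")
      case True
      then obtain k where k: "k \<in> M" "t = \<alpha> k" by blast
      have "reachable N M \<alpha> \<beta> ((\<gamma> \<circ> \<alpha>)(k := z)) \<beta>1"
        using z supp t b1z k by (intro reachable.jump[OF R1]) (auto simp: T_def)
      then show ?thesis
        by (rule reachable.same) (use k \<alpha>(1) in \<open>auto dest: inj_onD\<close>)
    next
      case False
      from R1 show ?thesis by (rule reachable.same) (use False in auto)
    qed
    have "\<gamma> t \<notin> (\<gamma>(t := z) \<circ> \<alpha>) ` M"
    proof
      assume "\<gamma> t \<in> (\<gamma>(t := z) \<circ> \<alpha>) ` M"
      then obtain k where k: "k \<in> M" "\<gamma> t = (\<gamma>(t := z)) (\<alpha> k)" by auto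
      moreover have "\<alpha> k \<in> T" using k by (simp add: T_def)
      ultimately show False using \<gamma>(1) t z by (auto split: if_splits dest: inj_onD)
    qed
    moreover have "\<beta>1(\<gamma> t := \<beta>2 (\<gamma> t)) = \<beta>2" by (auto simp: \<beta>1_def)
    moreover have "\<gamma> t \<in> N" using \<gamma>(2) t by blast
    moreover from this have "\<beta>2 (\<gamma> t) \<in> \<beta>1 ` N" using im1 \<beta>2(1) by blast
    ultimately show "reachable N M \<alpha> \<beta> (\<gamma>(t := z) \<circ> \<alpha>) \<beta>2"
      using reachable.recolour[OF R2, of "\<gamma> t" "\<beta>2 (\<gamma> t)"] im1 im2 by (metis DiffI)
  qed
  define \<gamma>' where "\<gamma>' t = (if t \<in> \<alpha> ` M then \<alpha>' (inv_into M \<alpha> t) else \<rho>' (\<beta> t))" for t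
  have \<gamma>'\<alpha>: "\<gamma>' (\<alpha> k) = \<alpha>' k" if "k \<in> M" for k using that \<alpha>(1) by (simp add: \<gamma>'_def)
  have \<gamma>'\<rho>: "\<gamma>' (\<rho> c) = \<rho>' c" if "c \<in> U" for c
  proof -
    have "\<beta> (\<rho> c) \<notin> \<beta> ` \<alpha> ` M" using \<rho>[OF that] that by (simp add: U_def)
    then have "\<rho> c \<notin> \<alpha> ` M" by blast
    then show ?thesis using \<rho>[OF that] by (simp add: \<gamma>'_def)
  qed
  have col': "\<beta>' (\<gamma>' t) = \<beta> t" if "t \<in> T" for t
    using that \<gamma>'\<alpha> \<gamma>'\<rho> eq \<rho> \<rho>' by (auto simp: T_def)
  have "\<gamma>' ` T \<subseteq> N" using \<gamma>'\<alpha> \<gamma>'\<rho> \<alpha>'(2) \<rho>' by (auto simp: T_def)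
  moreover have "inj_on \<gamma>' T"
  proof (rule inj_onI)
    fix s t assume st: "s \<in> T" "t \<in> T" "\<gamma>' s = \<gamma>' t"
    then have \<beta>st: "\<beta> s = \<beta> t" using col' by metis
    from st(1,2) consider k l where "k \<in> M" "s = \<alpha> k" "l \<in> M" "t = \<alpha> l"
      | c d where "c \<in> U" "s = \<rho> c" "d \<in> U" "t = \<rho> d"
      | k d where "k \<in> M" "s = \<alpha> k" "d \<in> U" "t = \<rho> d"
      | c l where "c \<in> U" "s = \<rho> c" "l \<in> M" "t = \<alpha> l"
      unfolding T_def by blast
    then show "s = t"
    proof cases
      case 1
      then show ?thesis using st(3) \<gamma>'\<alpha> \<alpha>'(1) by (auto dest: inj_onD)
    next
      case 2
      then show ?thesis using \<beta>st \<rho> by auto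
    next
      case 3
      then have "\<beta> (\<alpha> k) = d" using \<beta>st \<rho> by auto
      with 3 show ?thesis by (auto simp: U_def)
    next
      case 4
      then have "\<beta> (\<alpha> l) = c" using \<beta>st \<rho> by auto
      with 4 show ?thesis by (auto simp: U_def)
    qed
  qed
  ultimately obtain \<delta> where \<delta>: "Z \<delta>" "\<forall>t\<in>T. \<delta> t = \<gamma>' t"
    using injections_connected[of Z T N \<gamma>' id] step N cardT finT \<open>Z id\<close> TN by auto
  have "reachable N M \<alpha> \<beta> (\<delta> \<circ> \<alpha>) \<beta>'"
    using \<delta> col' im by (simp add: Z_def)
  then show ?thesis
    by (rule reachable.same) (use \<delta>(2) \<gamma>'\<alpha> in \<open>auto simp: T_def\<close>)
qed

section \<open>Moves are walks\<close>

text \<open>Some walk from \<open>u\<close> ends in the vertex and label that encode the configuration \<open>(\<alpha>, \<beta>)\<close>.\<close>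

definition walked :: "nat \<Rightarrow> nat \<Rightarrow> nat \<Rightarrow> vertex \<Rightarrow> (nat \<Rightarrow> nat) \<Rightarrow> (nat \<Rightarrow> nat) \<Rightarrow> bool" where
  "walked n m r u \<alpha> \<beta> \<longleftrightarrow> (\<exists>B Q a c. walk n m r u (a, c) (B, Q) \<and>
     a permutes {1..m} \<and> c permutes {1..r} \<and> (\<forall>k\<in>{1..m}. elt B (a k) = \<alpha> k) \<and>
     (\<forall>l\<in>{1..r}. cls Q (c l) = {x \<in> {1..n}. \<beta> x = l}))"

lemma walkedD:
  assumes "walked n m r u \<alpha> \<beta>"
  shows "inj_on \<alpha> {1..m}" "\<alpha> ` {1..m} \<subseteq> {1..n}" "\<beta> ` {1..n} = {1..r}"
proof -
  obtain B Q a c where w: "walk n m r u (a, c) (B, Q)" and a: "a permutes {1..m}"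
    and c: "c permutes {1..r}" and ea: "\<forall>k\<in>{1..m}. elt B (a k) = \<alpha> k"
    and ec: "\<forall>l\<in>{1..r}. cls Q (c l) = {x \<in> {1..n}. \<beta> x = l}"
    using assms by (auto simp: walked_def)
  have B: "B \<in> Lam n m" and Q: "Q \<in> Part n r" using walk_vertex[OF w] by (auto simp: vertices_def)
  have "bij_betw (elt B \<circ> a) {1..m} B"
    by (rule bij_betw_trans[OF permutes_imp_bij[OF a] Lam_bij[OF B]])
  then have "bij_betw \<alpha> {1..m} B" using ea by (simp cong: bij_betw_cong)
  then show "inj_on \<alpha> {1..m}" "\<alpha> ` {1..m} \<subseteq> {1..n}" using B by (auto simp: bij_betw_def Lam_def)
  have "bij_betw (cls Q \<circ> c) {1..r} Q"
    by (rule bij_betw_trans[OF permutes_imp_bij[OF c] Part_bij[OF Q]])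
  then have cQ: "bij_betw (\<lambda>l. {x \<in> {1..n}. \<beta> x = l}) {1..r} Q" using ec by (simp cong: bij_betw_cong)
  show "\<beta> ` {1..n} = {1..r}"
  proof (intro equalityI subsetI)
    fix l assume "l \<in> {1..r}"
    then have "{x \<in> {1..n}. \<beta> x = l} \<noteq> {}"
      using bij_betw_in[OF cQ] Part_class(1)[OF Q] by blast
    then show "l \<in> \<beta> ` {1..n}" by blast
  next
    fix l assume "l \<in> \<beta> ` {1..n}"
    then obtain x where x: "x \<in> {1..n}" "\<beta> x = l" by blast
    obtain C where C: "C \<in> Q" "x \<in> C" using Part_cover[OF Q x(1)] .
    obtain l' where "l' \<in> {1..r}" "{x \<in> {1..n}. \<beta> x = l'} = C" using bij_betw_obtain[OF cQ C(1)] .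
    with C x show "l \<in> {1..r}" by auto
  qed
qed

lemma relabel:
  assumes f: "bij_betw f {1..m} S" and g: "bij_betw g {1..m} S"
  obtains a :: "nat \<Rightarrow> nat" where "a permutes {1..m}" "\<forall>k\<in>{1..m}. g (a k) = f k"
proof -
  define a where "a k = (if k \<in> {1..m} then inv_into {1..m} g (f k) else k)" for k
  have "bij_betw (inv_into {1..m} g \<circ> f) {1..m} {1..m}"
    by (rule bij_betw_trans[OF f bij_betw_inv_into[OF g]])
  then have "bij_betw a {1..m} {1..m}" by (simp add: a_def cong: bij_betw_cong)
  then have "a permutes {1..m}" by (rule bij_imp_permutes) (simp add: a_def)
  moreover have "\<forall>k\<in>{1..m}. g (a k) = f k"
  proof
    fix k assume that: "k \<in> {1..m}"
    have "f k \<in> g ` {1..m}" using f g that by (auto simp: bij_betw_def)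
    then show "g (a k) = f k" using that by (simp add: a_def f_inv_into_f)
  qed
  ultimately show thesis by (rule that)
qed

lemma fibres_Part:
  assumes "\<beta> ` {1..n} = {1..r}"
  shows "(\<lambda>l. {x \<in> {1..n}. \<beta> x = l}) ` {1..r} \<in> Part n r"
    and "bij_betw (\<lambda>l. {x \<in> {1..n}. \<beta> x = l}) {1..r} ((\<lambda>l. {x \<in> {1..n}. \<beta> x = l}) ` {1..r})"
proof -
  show "(\<lambda>l. {x \<in> {1..n}. \<beta> x = l}) ` {1..r} \<in> Part n r"
    using partition_on_ker[of n \<beta>] card_ker[of n \<beta>] assms by (simp add: Part_def ker_eq)
  have "inj_on (\<lambda>l. {x \<in> {1..n}. \<beta> x = l}) {1..r}"
  proof (rule inj_onI)
    fix k l assume k: "k \<in> {1..r}" and eq: "{x \<in> {1..n}. \<beta> x = k} = {x \<in> {1..n}. \<beta> x = l}"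
    from k obtain x where "x \<in> {1..n}" "\<beta> x = k" using assms by (metis imageE)
    with eq show "k = l" by blast
  qed
  then show "bij_betw (\<lambda>l. {x \<in> {1..n}. \<beta> x = l}) {1..r} ((\<lambda>l. {x \<in> {1..n}. \<beta> x = l}) ` {1..r})"
    by (rule inj_on_imp_bij_betw)
qed

text \<open>If \<open>(a, c)\<close> and \<open>(a', c')\<close> encode the two configurations, then the quotient of these
  labels is the label of the edge for \<open>e\<close> by \<open>edge_iff\<close>.\<close>

lemma walked_edge:
  assumes w: "walked n m r u \<alpha> \<beta>" and e: "e \<in> idems n" and mr: "0 < m" "0 < r"
    and \<alpha>': "inj_on \<alpha>' {1..m}" "\<alpha>' ` {1..m} \<subseteq> {1..n}" "\<And>k. k \<in> {1..m} \<Longrightarrow> e (\<alpha>' k) = \<alpha> k"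
    and \<beta>': "\<beta>' ` {1..n} = {1..r}" "\<And>x. x \<in> {1..n} \<Longrightarrow> \<beta>' x = \<beta> (e x)"
  shows "walked n m r u \<alpha>' \<beta>'"
proof -
  obtain B Q a c where w: "walk n m r u (a, c) (B, Q)" and a: "a permutes {1..m}"
    and c: "c permutes {1..r}" and ea: "\<And>k. k \<in> {1..m} \<Longrightarrow> elt B (a k) = \<alpha> k"
    and ec: "\<And>l. l \<in> {1..r} \<Longrightarrow> cls Q (c l) = {x \<in> {1..n}. \<beta> x = l}"
    using w by (auto simp: walked_def)
  define B' where "B' = \<alpha>' ` {1..m}"
  define Q' where "Q' = (\<lambda>l. {x \<in> {1..n}. \<beta>' x = l}) ` {1..r}"
  have B': "B' \<in> Lam n m" using \<alpha>' by (simp add: B'_def Lam_def card_image)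
  have Q': "Q' \<in> Part n r" unfolding Q'_def by (rule fibres_Part(1)[OF \<beta>'(1)])
  have "bij_betw \<alpha>' {1..m} B'" using \<alpha>'(1) by (simp add: B'_def bij_betw_def)
  then obtain a' where a': "a' permutes {1..m}" "\<forall>k\<in>{1..m}. elt B' (a' k) = \<alpha>' k"
    by (rule relabel[OF _ Lam_bij[OF B']])
  have "bij_betw (\<lambda>l. {x \<in> {1..n}. \<beta>' x = l}) {1..r} Q'"
    unfolding Q'_def by (rule fibres_Part(2)[OF \<beta>'(1)])
  then obtain c' where c': "c' permutes {1..r}"
    "\<forall>l\<in>{1..r}. cls Q' (c' l) = {x \<in> {1..n}. \<beta>' x = l}"
    by (rule relabel[OF _ Part_bij[OF Q']])
  have V: "(B', Q') \<in> vertices n m r" using B' Q' by (simp add: vertices_def)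
  have "edge n m r (B, Q) (inv a \<circ>> a', inv c \<circ>> c') (B', Q')"
    unfolding edge_iff[OF walk_vertex[OF w] V mr]
  proof (intro conjI bexI[OF _ e] ballI)
    show "inv a \<circ>> a' permutes {1..m}" "inv c \<circ>> c' permutes {1..r}"
      unfolding fcomp_comp by (intro permutes_compose permutes_inv a c a' c')+
    fix k assume k: "k \<in> {1..m}"
    define j where "j = inv a k"
    have "j \<in> {1..m}" "a j = k"
      using permutes_in_image[OF permutes_inv[OF a]] permutes_inverses[OF a] k by (auto simp: j_def)
    then show "e (elt B' ((inv a \<circ>> a') k)) = elt B k"
      using a'(2) \<alpha>'(3) ea[of j] by (simp add: j_def[symmetric])
  next
    fix l assume l: "l \<in> {1..r}"
    define j where "j = inv c l"
    have j: "j \<in> {1..r}" "c j = l"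
      using permutes_in_image[OF permutes_inv[OF c]] permutes_inverses[OF c] l by (auto simp: j_def)
    have "{x \<in> {1..n}. \<beta>' x = j} = pre n e {x \<in> {1..n}. \<beta> x = j}"
      using \<beta>'(2) idems_in[OF e] by (auto simp: pre_def)
    then show "cls Q' ((inv c \<circ>> c') l) = pre n e (cls Q l)"
      using c'(2) ec[of j] j by (simp add: j_def[symmetric])
  qed
  then have "walk n m r u (label_mul (a, c) (inv a \<circ>> a', inv c \<circ>> c')) (B', Q')"
    by (rule walk.forward[OF w])
  moreover have "label_mul (a, c) (inv a \<circ>> a', inv c \<circ>> c') = (a', c')"
    using permutes_inverses[OF a] permutes_inverses[OF c] by (simp add: label_mul_def fun_eq_iff)
  ultimately show ?thesis unfolding walked_def using a' c' by auto
qed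

lemma point_idem: 
  assumes "y \<in> {1..n}" shows "restrict (id(x := y)) {1..n} \<in> idems n"
  using assms by (intro restrict_idem) auto

text \<open>Both moves are edges for the idempotent that maps \<open>x\<close> to a point \<open>y\<close> and fixes the
  rest.  To recolour \<open>x\<close>, take for \<open>y\<close> any position of the new colour; to move a token to \<open>x\<close>,
  take its old position.\<close>

lemma reachable_walked:
  assumes "reachable {1..n} {1..m} \<alpha>0 \<beta>0 \<alpha> \<beta>" and w: "walked n m r u \<alpha>0 \<beta>0" and mr: "0 < m" "0 < r"
  shows "walked n m r u \<alpha> \<beta>"
  using assms(1)
proof (induction rule: reachable.induct)
  case start
  show ?case by (rule w)
next
  case (same \<alpha> \<beta> \<alpha>' \<beta>')
  have "{x \<in> {1..n}. \<beta>' x = l} = {x \<in> {1..n}. \<beta> x = l}" for l using same by auto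
  with same show ?case by (simp add: walked_def)
next
  case (recolour \<alpha> \<beta> x c)
  note wD = walkedD[OF recolour.IH]
  obtain y where y: "y \<in> {1..n}" "\<beta> y = c" using recolour.hyps by blast
  show ?case
  proof (rule walked_edge[OF recolour.IH point_idem[OF y(1), of x] mr wD(1,2)])
    fix k assume k: "k \<in> {1..m}"
    then have "\<alpha> k \<noteq> x" "\<alpha> k \<in> {1..n}" using recolour.hyps wD(2) by auto
    then show "restrict (id(x := y)) {1..n} (\<alpha> k) = \<alpha> k" by simp
  qed (use recolour.hyps wD(3) y in auto)
next
  case (jump \<alpha> \<beta> k x)
  note wD = walkedD[OF jump.IH]
  have y: "\<alpha> k \<in> {1..n}" using jump.hyps wD(2) by blast
  show ?case
  proof (rule walked_edge[OF jump.IH point_idem[OF y, of x] mr])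
    show "inj_on (\<alpha>(k := x)) {1..m}" using wD(1) jump.hyps by (simp add: inj_on_fun_updI)
    show "\<alpha>(k := x) ` {1..m} \<subseteq> {1..n}" using wD(2) jump.hyps by auto
    fix j assume j: "j \<in> {1..m}"
    then have "\<alpha> j \<noteq> x" "\<alpha> j \<in> {1..n}" using jump.hyps wD(2) by auto
    then show "restrict (id(x := \<alpha> k)) {1..n} ((\<alpha>(k := x)) j) = \<alpha> j" using jump.hyps by simp
  qed (use jump.hyps wD(3) y in auto)
qed

lemma obtain_colouring:
  assumes P: "P \<in> Part n r"
  obtains \<beta> where "\<beta> ` {1..n} = {1..r}" "\<forall>l\<in>{1..r}. cls P l = {x \<in> {1..n}. \<beta> x = l}"
proof -
  note cP = Part_bij[OF P]
  have "\<exists>l. l \<in> {1..r} \<and> x \<in> cls P l" if "x \<in> {1..n}" for x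
    using Part_cover[OF P that] bij_betw_obtain[OF cP] by metis
  then obtain \<beta> where \<beta>: "\<And>x. x \<in> {1..n} \<Longrightarrow> \<beta> x \<in> {1..r} \<and> x \<in> cls P (\<beta> x)" by metis
  have cls: "cls P l = {x \<in> {1..n}. \<beta> x = l}" if l: "l \<in> {1..r}" for l
  proof (intro equalityI subsetI)
    fix x assume x: "x \<in> cls P l"
    then have xn: "x \<in> {1..n}" using Part_class(2)[OF P bij_betw_in[OF cP l]] by blast
    then have "cls P l = cls P (\<beta> x)" using Part_disjoint[OF P] bij_betw_in[OF cP] l x \<beta> by blast
    then show "x \<in> {x \<in> {1..n}. \<beta> x = l}" using bij_betw_eq[OF cP l] \<beta> xn by auto
  qed (use \<beta> in auto)
  have "\<beta> ` {1..n} = {1..r}"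
  proof (intro equalityI subsetI)
    fix l assume l: "l \<in> {1..r}"
    then have "cls P l \<noteq> {}" using Part_class(1)[OF P bij_betw_in[OF cP]] by blast
    then show "l \<in> \<beta> ` {1..n}" using cls[OF l] by auto
  qed (use \<beta> in auto)
  with cls show thesis by (intro that) blast+
qed

text \<open>The configuration \<open>(elt A \<circ> p, inv q \<circ> \<beta>)\<close> encodes the vertex \<open>(A, P)\<close> with label
  \<open>(p, q)\<close>.  That \<open>(p, q)\<close> is an auto-homeomorphism means that every token has the same colour
  as in the initial configuration \<open>(elt A, \<beta>)\<close>, and a point outside \<open>A\<close> in a class with at least
  two points serves as the empty position.\<close>

lemma AHom_subset_vertex_group:
  assumes V: "(A, P) \<in> vertices n m r" and mr: "0 < m" "0 < r" and ns: "\<not> stationary A P"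
  shows "AHom A P \<subseteq> vertex_group n m r (A, P)"
proof
  fix g assume "g \<in> AHom A P"
  then have "homeo m r (A, P) g (A, P)" using AHom_homeo[OF V] by simp
  moreover obtain p q where g: "g = (p, q)" by (cases g)
  ultimately have p: "p permutes {1..m}" and q: "q permutes {1..r}"
    and inc: "\<And>i j. i \<in> {1..m} \<Longrightarrow> j \<in> {1..r} \<Longrightarrow> elt A i \<in> cls P j \<longleftrightarrow> elt A (p i) \<in> cls P (q j)"
    by (auto simp: homeo_def)
  have A: "A \<in> Lam n m" and P: "P \<in> Part n r" using V by (auto simp: vertices_def)
  have An: "A \<subseteq> {1..n}" using A by (simp add: Lam_def)
  note eA = Lam_bij[OF A]
  obtain \<beta> where \<beta>: "\<beta> ` {1..n} = {1..r}" "\<forall>l\<in>{1..r}. cls P l = {x \<in> {1..n}. \<beta> x = l}"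
    using obtain_colouring[OF P] .
  have start: "walked n m r (A, P) (elt A) \<beta>"
    unfolding walked_def using walk.empty[OF V] \<beta>(2) permutes_id
    by (intro exI[of _ A] exI[of _ P] exI[of _ id]) simp
  have pA: "bij_betw (elt A \<circ> p) {1..m} A"
    by (rule bij_betw_trans[OF permutes_imp_bij[OF p] eA])
  have pn: "p k \<in> {1..m}" if "k \<in> {1..m}" for k using permutes_in_image[OF p] that by simp
  have An': "elt A k \<in> {1..n}" if "k \<in> {1..m}" for k using bij_betw_in[OF eA that] An by blast
  have \<beta>r: "\<beta> x \<in> {1..r}" if "x \<in> {1..n}" for x using \<beta>(1) that by blast
  from ns obtain C x where C: "C \<in> P" "x \<in> C" "x \<notin> A" "\<not> is_singleton C"
    by (auto simp: stationary_def)
  then have "C \<noteq> {x}" by auto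
  with C obtain y where y: "y \<in> C" "y \<noteq> x" by blast
  obtain l where l: "l \<in> {1..r}" "cls P l = C" using bij_betw_obtain[OF Part_bij[OF P] C(1)] .
  have "reachable {1..n} {1..m} (elt A) \<beta> (elt A \<circ> p) (inv q \<circ> \<beta>)"
  proof (rule puzzle_connected)
    show "inj_on (elt A) {1..m}" "elt A ` {1..m} \<subseteq> {1..n}"
      "inj_on (elt A \<circ> p) {1..m}" "(elt A \<circ> p) ` {1..m} \<subseteq> {1..n}"
      using eA pA An by (auto simp: bij_betw_def)
    show "(inv q \<circ> \<beta>) ` {1..n} = \<beta> ` {1..n}"
      using \<beta>(1) permutes_image[OF permutes_inv[OF q]] by (metis image_comp)
    show "(inv q \<circ> \<beta>) ((elt A \<circ> p) k) = \<beta> (elt A k)" if k: "k \<in> {1..m}" for k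
    proof -
      have "elt A (p k) \<in> cls P (q (\<beta> (elt A k)))"
        using inc[OF k \<beta>r[OF An'[OF k]]] \<beta>(2) \<beta>r An' k by simp
      moreover have "q (\<beta> (elt A k)) \<in> {1..r}" using permutes_in_image[OF q] \<beta>r An' k by simp
      ultimately have "\<beta> (elt A (p k)) = q (\<beta> (elt A k))" using \<beta>(2) by simp
      then show ?thesis using permutes_inverses[OF q] by simp
    qed
    show "x \<in> {1..n} - elt A ` {1..m}" "y \<in> {1..n}" "\<beta> y = \<beta> x"
      using C y l \<beta>(2) l(1) eA by (auto simp: bij_betw_def)
  qed (use y in auto)
  then have "walked n m r (A, P) (elt A \<circ> p) (inv q \<circ> \<beta>)" using start mr by (rule reachable_walked)
  then obtain B Q a c where w: "walk n m r (A, P) (a, c) (B, Q)" and a: "a permutes {1..m}"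
    and c: "c permutes {1..r}" and ea: "\<And>k. k \<in> {1..m} \<Longrightarrow> elt B (a k) = elt A (p k)"
    and ec: "\<And>l. l \<in> {1..r} \<Longrightarrow> cls Q (c l) = {x \<in> {1..n}. inv q (\<beta> x) = l}"
    by (auto simp: walked_def)
  have B: "B \<in> Lam n m" and Q: "Q \<in> Part n r" using walk_vertex[OF w] by (auto simp: vertices_def)
  have ec': "cls Q (c l) = cls P (q l)" if "l \<in> {1..r}" for l
  proof -
    have "inv q (\<beta> x) = l \<longleftrightarrow> \<beta> x = q l" for x using permutes_inv_eq[OF q] by metis
    then show ?thesis using ec[OF that] \<beta>(2) permutes_in_image[OF q] that by simp
  qed
  have bB: "bij_betw (elt B \<circ> a) {1..m} B"
    by (rule bij_betw_trans[OF permutes_imp_bij[OF a] Lam_bij[OF B]])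
  have "B = (\<lambda>k. elt B (a k)) ` {1..m}" using bB by (simp add: bij_betw_def comp_def)
  also have "\<dots> = (\<lambda>k. elt A (p k)) ` {1..m}" using ea by (rule image_cong[OF HOL.refl])
  also have "\<dots> = A" using pA by (simp add: bij_betw_def comp_def)
  finally have BA: "B = A" .
  have bQ: "bij_betw (cls Q \<circ> c) {1..r} Q"
    by (rule bij_betw_trans[OF permutes_imp_bij[OF c] Part_bij[OF Q]])
  have bP: "bij_betw (cls P \<circ> q) {1..r} P"
    by (rule bij_betw_trans[OF permutes_imp_bij[OF q] Part_bij[OF P]])
  have "Q = (\<lambda>l. cls Q (c l)) ` {1..r}" using bQ by (simp add: bij_betw_def comp_def)
  also have "\<dots> = (\<lambda>l. cls P (q l)) ` {1..r}" using ec' by (rule image_cong[OF HOL.refl])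
  also have "\<dots> = P" using bP by (simp add: bij_betw_def comp_def)
  finally have QP: "Q = P" .
  have "a = p"
  proof (rule permutes_eqI[OF a p])
    fix k assume "k \<in> {1..m}"
    then show "a k = p k"
      using ea bij_betw_eq[OF eA] permutes_in_image[OF a] pn unfolding BA by blast
  qed
  moreover have "c = q"
  proof (rule permutes_eqI[OF c q])
    fix l assume l: "l \<in> {1..r}"
    have "cls P (c l) = cls P (q l)" using ec'[OF l] unfolding QP .
    moreover have "c l \<in> {1..r}" "q l \<in> {1..r}"
      using l permutes_in_image[OF c] permutes_in_image[OF q] by simp_all
    ultimately show "c l = q l" using bij_betw_eq[OF Part_bij[OF P]] by simp
  qed
  ultimately show "g \<in> vertex_group n m r (A, P)"
    using w BA QP g by (simp add: vertex_group_def)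
qed

theorem theorem3p13:
  fixes n m r :: nat and A :: "nat set" and P :: "nat set set"
  assumes "0 < n" and "0 < m" and "0 < r"
    and "m + 2 \<le> n" and "r + 2 \<le> n"
    and "(A, P) \<in> vertices n m r"
  shows "(\<not> stationary A P \<longrightarrow> vertex_group n m r (A, P) = AHom A P) \<and>
         (stationary A P \<longrightarrow> vertex_group n m r (A, P) = {(id, id)})"
proof (intro conjI impI)
  assume "\<not> stationary A P"
  then have "AHom A P \<subseteq> vertex_group n m r (A, P)"
    using AHom_subset_vertex_group assms by blast
  moreover have "vertex_group n m r (A, P) \<subseteq> AHom A P"
    unfolding vertex_group_def AHom_homeo[OF assms(6)] using walk_homeo assms(2,3) by blast
  ultimately show "vertex_group n m r (A, P) = AHom A P" by blast
next
  assume "stationary A P"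
  then have "vertex_group n m r (A, P) \<subseteq> {(id, id)}"
    using stationary_walk[OF _ assms(2,3)] by (fastforce simp: vertex_group_def)
  then show "vertex_group n m r (A, P) = {(id, id)}"
    using walk.empty[OF assms(6)] by (auto simp: vertex_group_def)
qed

end
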